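(* For all small categories $\mathcal A,\mathcal B$, the forgetful functor $\mathbf{2TDX}(\mathcal A,\mathcal B)\to\mathbf{Cat}$, $(\mathcal Q,t)\mapsto\mathcal Q$, $(F,\theta)\mapsto F$, is a fibration, and the category $\mathbf{2TDX}(\mathcal A,\mathcal B)$ is small complete and small cocomplete.
   Context: $\mathbf{Cat}$ is the category of small categories and functors. $\mathcal B^*$ is the free monoidal category on $\mathcal B$: objects are finite lists of objects of $\mathcal B$, morphisms between lists of the same length are tuples of morphisms of $\mathcal B$, and there are none between lists of different lengths. The category $\mathbf{2TDX}(\mathcal A,\mathcal B)$ of 2-transducers has as objects the pairs $(\mathcal Q,t)$ with $\mathcal Q$ a small category and $t:\mathcal A\times\mathcal Q^{op}\times\mathcal Q\times(\mathcal B^* )^{op}\to\mathrm{Set}$ a functor, and as morphisms $(\mathcal P,s)\to(\mathcal Q,t)$ the pairs $(F,\theta)$ with $F:\mathcal P\to\mathcal Q$ a functor and $\theta$ a natural transformation with components $s(a,p,p',\underline b)\to t(a,Fp,Fp',\underline b)$. *)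

theory Defs
  imports "HOL-Library.FuncSet"
begin

(* HOL has no proper classes, so the ambient set theory is a type 'v whose elements are the
   (small) sets and which satisfies second-order ZFC; choice is inherited from HOL.  A collection
   of elements of 'v is small when it is the extension of an element of 'v. *)

class zfc_universe =
  fixes elts :: "'a \<Rightarrow> 'a set"
  assumes elts_extensionality: "elts x = elts y \<Longrightarrow> x = y"
    and elts_foundation: "wf {(x, y). x \<in> elts y}"
    and elts_separation: "Y \<subseteq> elts x \<Longrightarrow> Y \<in> range elts"
    and elts_Union: "\<Union> (elts ` elts x) \<in> range elts"
    and elts_power: "{y. elts y \<subseteq> elts x} \<in> range elts"
    and elts_replacement: "f ` elts x \<in> range elts"
    and elts_infinity: "range (g :: nat \<Rightarrow> 'a) \<in> range elts"

definition small :: "'v::zfc_universe set \<Rightarrow> bool" where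
  "small X \<longleftrightarrow> X \<in> range elts"


section \<open>Categories, functors, natural transformations\<close>

record ('o, 'm) category =
  Obj :: "'o set"
  Arr :: "'m set"
  Dom :: "'m \<Rightarrow> 'o"
  Cod :: "'m \<Rightarrow> 'o"
  Ident :: "'o \<Rightarrow> 'm"
  Comp :: "'m \<Rightarrow> 'm \<Rightarrow> 'm"  (* Comp C g f is g after f, meaningful only if Dom g = Cod f *)

definition Hom :: "('o, 'm) category \<Rightarrow> 'o \<Rightarrow> 'o \<Rightarrow> 'm set" where
  "Hom C x y = {f \<in> Arr C. Dom C f = x \<and> Cod C f = y}"

definition category :: "('o, 'm) category \<Rightarrow> bool" where
  "category C \<longleftrightarrow>
     (\<forall>f\<in>Arr C. Dom C f \<in> Obj C \<and> Cod C f \<in> Obj C) \<and>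
     (\<forall>x\<in>Obj C. Ident C x \<in> Hom C x x) \<and>
     (\<forall>f\<in>Arr C. \<forall>g\<in>Arr C. Dom C g = Cod C f \<longrightarrow> Comp C g f \<in> Hom C (Dom C f) (Cod C g)) \<and>
     (\<forall>f\<in>Arr C. Comp C f (Ident C (Dom C f)) = f \<and> Comp C (Ident C (Cod C f)) f = f) \<and>
     (\<forall>f\<in>Arr C. \<forall>g\<in>Arr C. \<forall>h\<in>Arr C. Dom C g = Cod C f \<longrightarrow> Dom C h = Cod C g \<longrightarrow>
        Comp C h (Comp C g f) = Comp C (Comp C h g) f)"

definition small_category :: "('v::zfc_universe, 'v) category \<Rightarrow> bool" where
  "small_category C \<longleftrightarrow> category C \<and> small (Obj C) \<and> small (Arr C)"

(* The operations of a record are total functions; fixing their values off the intended domain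
   makes equality of records coincide with equality of categories. *)
definition normalized :: "('o, 'm) category \<Rightarrow> bool" where
  "normalized C \<longleftrightarrow>
     Dom C \<in> extensional (Arr C) \<and> Cod C \<in> extensional (Arr C) \<and> Ident C \<in> extensional (Obj C) \<and>
     (\<forall>g f. \<not> (f \<in> Arr C \<and> g \<in> Arr C \<and> Dom C g = Cod C f) \<longrightarrow> Comp C g f = undefined)"

record ('o, 'm, 'p, 'n) functor_maps =
  OMap :: "'o \<Rightarrow> 'p"
  AMap :: "'m \<Rightarrow> 'n"

definition is_functor ::
  "('o, 'm) category \<Rightarrow> ('p, 'n) category \<Rightarrow> ('o, 'm, 'p, 'n) functor_maps \<Rightarrow> bool" where
  "is_functor C D F \<longleftrightarrow>
     category C \<and> category D \<and>
     OMap F \<in> Obj C \<rightarrow>\<^sub>E Obj D \<and> AMap F \<in> Arr C \<rightarrow>\<^sub>E Arr D \<and>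
     (\<forall>f\<in>Arr C. Dom D (AMap F f) = OMap F (Dom C f) \<and> Cod D (AMap F f) = OMap F (Cod C f)) \<and>
     (\<forall>x\<in>Obj C. AMap F (Ident C x) = Ident D (OMap F x)) \<and>
     (\<forall>f\<in>Arr C. \<forall>g\<in>Arr C. Dom C g = Cod C f \<longrightarrow>
        AMap F (Comp C g f) = Comp D (AMap F g) (AMap F f))"

definition id_functor :: "('o, 'm) category \<Rightarrow> ('o, 'm, 'o, 'm) functor_maps" where
  "id_functor C = \<lparr>OMap = restrict id (Obj C), AMap = restrict id (Arr C)\<rparr>"

definition comp_functor ::
  "('o, 'm) category \<Rightarrow> ('p, 'n, 'q, 'l) functor_maps \<Rightarrow> ('o, 'm, 'p, 'n) functor_maps
     \<Rightarrow> ('o, 'm, 'q, 'l) functor_maps" where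
  "comp_functor C G F =
     \<lparr>OMap = compose (Obj C) (OMap G) (OMap F), AMap = compose (Arr C) (AMap G) (AMap F)\<rparr>"

definition is_nat_trans ::
  "('o, 'm) category \<Rightarrow> ('p, 'n) category \<Rightarrow> ('o, 'm, 'p, 'n) functor_maps
     \<Rightarrow> ('o, 'm, 'p, 'n) functor_maps \<Rightarrow> ('o \<Rightarrow> 'n) \<Rightarrow> bool" where
  "is_nat_trans C D F G \<theta> \<longleftrightarrow>
     is_functor C D F \<and> is_functor C D G \<and>
     \<theta> \<in> extensional (Obj C) \<and>
     (\<forall>x\<in>Obj C. \<theta> x \<in> Hom D (OMap F x) (OMap G x)) \<and>
     (\<forall>f\<in>Arr C. Comp D (\<theta> (Cod C f)) (AMap F f) = Comp D (AMap G f) (\<theta> (Dom C f)))"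


section \<open>Opposites, products, free monoidal categories\<close>

definition op_cat :: "('o, 'm) category \<Rightarrow> ('o, 'm) category" where
  "op_cat C = \<lparr>Obj = Obj C, Arr = Arr C, Dom = Cod C, Cod = Dom C, Ident = Ident C,
     Comp = (\<lambda>g f. Comp C f g)\<rparr>"

definition prod_cat ::
  "('o, 'm) category \<Rightarrow> ('p, 'n) category \<Rightarrow> ('o \<times> 'p, 'm \<times> 'n) category" (infixr "\<times>\<^sub>C" 80) where
  "C \<times>\<^sub>C D = \<lparr>Obj = Obj C \<times> Obj D, Arr = Arr C \<times> Arr D,
     Dom = map_prod (Dom C) (Dom D), Cod = map_prod (Cod C) (Cod D),
     Ident = map_prod (Ident C) (Ident D),
     Comp = (\<lambda>(g, g') (f, f'). (Comp C g f, Comp D g' f'))\<rparr>"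

definition prod_functor ::
  "('o, 'm) category \<Rightarrow> ('o2, 'm2) category
     \<Rightarrow> ('o, 'm, 'p, 'n) functor_maps \<Rightarrow> ('o2, 'm2, 'p2, 'n2) functor_maps
     \<Rightarrow> ('o \<times> 'o2, 'm \<times> 'm2, 'p \<times> 'p2, 'n \<times> 'n2) functor_maps" where
  "prod_functor C D F G =
     \<lparr>OMap = restrict (map_prod (OMap F) (OMap G)) (Obj C \<times> Obj D),
      AMap = restrict (map_prod (AMap F) (AMap G)) (Arr C \<times> Arr D)\<rparr>"

definition free_monoidal :: "('o, 'm) category \<Rightarrow> ('o list, 'm list) category" where
  "free_monoidal C = \<lparr>Obj = lists (Obj C), Arr = lists (Arr C),
     Dom = map (Dom C), Cod = map (Cod C), Ident = map (Ident C), Comp = map2 (Comp C)\<rparr>"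


section \<open>The categories of small sets and of small categories\<close>

type_synonym 'v set_arrow = "'v \<times> ('v \<Rightarrow> 'v) \<times> 'v"

definition Set_cat :: "('v::zfc_universe, 'v set_arrow) category" where
  "Set_cat = \<lparr>Obj = UNIV, Arr = {(X, f, Y). f \<in> elts X \<rightarrow>\<^sub>E elts Y},
     Dom = (\<lambda>(X, f, Y). X), Cod = (\<lambda>(X, f, Y). Y),
     Ident = (\<lambda>X. (X, restrict id (elts X), X)),
     Comp = (\<lambda>(Y', g, Z) (X, f, Y). (X, compose (elts X) g f, Z))\<rparr>"

type_synonym 'v cat = "('v, 'v) category"
type_synonym 'v cat_functor = "('v, 'v, 'v, 'v) functor_maps"
type_synonym 'v cat_arrow = "'v cat \<times> 'v cat_functor \<times> 'v cat"

definition Cat :: "('v::zfc_universe cat, 'v cat_arrow) category" where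
  "Cat = \<lparr>Obj = {C. small_category C \<and> normalized C},
     Arr = {(C, F, D). small_category C \<and> normalized C \<and> small_category D \<and> normalized D \<and>
              is_functor C D F},
     Dom = (\<lambda>(C, F, D). C), Cod = (\<lambda>(C, F, D). D),
     Ident = (\<lambda>C. (C, id_functor C, C)),
     Comp = (\<lambda>(D', G, E) (C, F, D). (C, comp_functor C G F, E))\<rparr>"


section \<open>2-transducers\<close>

type_synonym 'v tdx_index = "'v \<times> 'v \<times> 'v \<times> 'v list"
type_synonym 'v tdx_table = "('v tdx_index, 'v tdx_index, 'v, 'v set_arrow) functor_maps"
type_synonym 'v tdx = "'v cat \<times> 'v tdx_table"
type_synonym 'v tdx_arrow =
  "'v tdx \<times> ('v cat_functor \<times> ('v tdx_index \<Rightarrow> 'v set_arrow)) \<times> 'v tdx"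

definition tdx_base :: "'v cat \<Rightarrow> 'v cat \<Rightarrow> 'v cat \<Rightarrow> ('v tdx_index, 'v tdx_index) category" where
  "tdx_base A B Q = A \<times>\<^sub>C op_cat Q \<times>\<^sub>C Q \<times>\<^sub>C op_cat (free_monoidal B)"

(* The functor (a, p, p', b) |-> (a, F p, F p', b); the opposite of F has the same maps as F. *)
definition tdx_base_functor ::
  "'v cat \<Rightarrow> 'v cat \<Rightarrow> 'v cat \<Rightarrow> 'v cat_functor
     \<Rightarrow> ('v tdx_index, 'v tdx_index, 'v tdx_index, 'v tdx_index) functor_maps" where
  "tdx_base_functor A B P F =
     (let M = op_cat (free_monoidal B) in
      prod_functor A (op_cat P \<times>\<^sub>C P \<times>\<^sub>C M) (id_functor A)
        (prod_functor (op_cat P) (P \<times>\<^sub>C M) F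
          (prod_functor P M F (id_functor M))))"

definition tdx_obj :: "'v::zfc_universe cat \<Rightarrow> 'v cat \<Rightarrow> 'v tdx set" where
  "tdx_obj A B = {(Q, t). Q \<in> Obj Cat \<and> is_functor (tdx_base A B Q) Set_cat t}"

definition tdx_arr :: "'v::zfc_universe cat \<Rightarrow> 'v cat \<Rightarrow> 'v tdx_arrow set" where
  "tdx_arr A B = {((P, s), (F, \<theta>), (Q, t)). (P, s) \<in> tdx_obj A B \<and> (Q, t) \<in> tdx_obj A B \<and>
     is_functor P Q F \<and>
     is_nat_trans (tdx_base A B P) Set_cat
       s (comp_functor (tdx_base A B P) t (tdx_base_functor A B P F)) \<theta>}"

definition tdx_ident :: "'v::zfc_universe cat \<Rightarrow> 'v cat \<Rightarrow> 'v tdx \<Rightarrow> 'v tdx_arrow" where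
  "tdx_ident A B = (\<lambda>(Q, t).
     ((Q, t), (id_functor Q, \<lambda>x\<in>Obj (tdx_base A B Q). Ident Set_cat (OMap t x)), (Q, t)))"

definition tdx_comp ::
  "'v::zfc_universe cat \<Rightarrow> 'v cat \<Rightarrow> 'v tdx_arrow \<Rightarrow> 'v tdx_arrow \<Rightarrow> 'v tdx_arrow" where
  "tdx_comp A B = (\<lambda>(Y', (G, \<eta>), Z) ((P, s), (F, \<theta>), Y).
     ((P, s),
      (comp_functor P G F,
       \<lambda>x\<in>Obj (tdx_base A B P).
         Comp Set_cat (\<eta> (OMap (tdx_base_functor A B P F) x)) (\<theta> x)),
      Z))"

definition TDX :: "'v::zfc_universe cat \<Rightarrow> 'v cat \<Rightarrow> ('v tdx, 'v tdx_arrow) category" where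
  "TDX A B = \<lparr>Obj = tdx_obj A B, Arr = tdx_arr A B,
     Dom = (\<lambda>(X, f, Y). X), Cod = (\<lambda>(X, f, Y). Y),
     Ident = tdx_ident A B, Comp = tdx_comp A B\<rparr>"

definition tdx_forget ::
  "'v::zfc_universe cat \<Rightarrow> 'v cat \<Rightarrow> ('v tdx, 'v tdx_arrow, 'v cat, 'v cat_arrow) functor_maps" where
  "tdx_forget A B =
     \<lparr>OMap = restrict fst (tdx_obj A B),
      AMap = restrict (\<lambda>((P, s), (F, \<theta>), (Q, t)). (P, F, Q)) (tdx_arr A B)\<rparr>"


section \<open>Fibrations\<close>

definition cartesian ::
  "('o, 'm) category \<Rightarrow> ('p, 'n) category \<Rightarrow> ('o, 'm, 'p, 'n) functor_maps \<Rightarrow> 'm \<Rightarrow> bool" where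
  "cartesian E C U \<phi> \<longleftrightarrow> \<phi> \<in> Arr E \<and>
     (\<forall>\<psi>\<in>Arr E. \<forall>g\<in>Hom C (OMap U (Dom E \<psi>)) (OMap U (Dom E \<phi>)).
        Cod E \<psi> = Cod E \<phi> \<longrightarrow> Comp C (AMap U \<phi>) g = AMap U \<psi> \<longrightarrow>
        (\<exists>!\<chi>. \<chi> \<in> Hom E (Dom E \<psi>) (Dom E \<phi>) \<and> AMap U \<chi> = g \<and> Comp E \<phi> \<chi> = \<psi>))"

definition fibration ::
  "('o, 'm) category \<Rightarrow> ('p, 'n) category \<Rightarrow> ('o, 'm, 'p, 'n) functor_maps \<Rightarrow> bool" where
  "fibration E C U \<longleftrightarrow> is_functor E C U \<and>
     (\<forall>e\<in>Obj E. \<forall>f\<in>Arr C. Cod C f = OMap U e \<longrightarrow>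
        (\<exists>\<phi>. cartesian E C U \<phi> \<and> Cod E \<phi> = e \<and> AMap U \<phi> = f))"


section \<open>Small limits and colimits\<close>

definition is_cone ::
  "('j, 'k) category \<Rightarrow> ('o, 'm) category \<Rightarrow> ('j, 'k, 'o, 'm) functor_maps
     \<Rightarrow> 'o \<Rightarrow> ('j \<Rightarrow> 'm) \<Rightarrow> bool" where
  "is_cone J C D x p \<longleftrightarrow> x \<in> Obj C \<and>
     (\<forall>j\<in>Obj J. p j \<in> Hom C x (OMap D j)) \<and>
     (\<forall>u\<in>Arr J. Comp C (AMap D u) (p (Dom J u)) = p (Cod J u))"

definition is_limit ::
  "('j, 'k) category \<Rightarrow> ('o, 'm) category \<Rightarrow> ('j, 'k, 'o, 'm) functor_maps
     \<Rightarrow> 'o \<Rightarrow> ('j \<Rightarrow> 'm) \<Rightarrow> bool" where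
  "is_limit J C D x p \<longleftrightarrow> is_cone J C D x p \<and>
     (\<forall>y q. is_cone J C D y q \<longrightarrow>
        (\<exists>!h. h \<in> Hom C y x \<and> (\<forall>j\<in>Obj J. Comp C (p j) h = q j)))"

definition is_cocone ::
  "('j, 'k) category \<Rightarrow> ('o, 'm) category \<Rightarrow> ('j, 'k, 'o, 'm) functor_maps
     \<Rightarrow> 'o \<Rightarrow> ('j \<Rightarrow> 'm) \<Rightarrow> bool" where
  "is_cocone J C D x i \<longleftrightarrow> x \<in> Obj C \<and>
     (\<forall>j\<in>Obj J. i j \<in> Hom C (OMap D j) x) \<and>
     (\<forall>u\<in>Arr J. Comp C (i (Cod J u)) (AMap D u) = i (Dom J u))"

definition is_colimit ::
  "('j, 'k) category \<Rightarrow> ('o, 'm) category \<Rightarrow> ('j, 'k, 'o, 'm) functor_maps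
     \<Rightarrow> 'o \<Rightarrow> ('j \<Rightarrow> 'm) \<Rightarrow> bool" where
  "is_colimit J C D x i \<longleftrightarrow> is_cocone J C D x i \<and>
     (\<forall>y q. is_cocone J C D y q \<longrightarrow>
        (\<exists>!h. h \<in> Hom C x y \<and> (\<forall>j\<in>Obj J. Comp C h (i j) = q j)))"

(* The type argument names the universe from which the indexing categories are taken. *)
definition small_complete :: "'v::zfc_universe itself \<Rightarrow> ('o, 'm) category \<Rightarrow> bool" where
  "small_complete V C \<longleftrightarrow> category C \<and>
     (\<forall>(J :: 'v cat) D. small_category J \<and> is_functor J C D \<longrightarrow> (\<exists>x p. is_limit J C D x p))"

definition small_cocomplete :: "'v::zfc_universe itself \<Rightarrow> ('o, 'm) category \<Rightarrow> bool" where
  "small_cocomplete V C \<longleftrightarrow> category C \<and>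
     (\<forall>(J :: 'v cat) D. small_category J \<and> is_functor J C D \<longrightarrow> (\<exists>x i. is_colimit J C D x i))"

end

(* The proof avoids Kan extensions and explicit colimits of categories.  A family of 2-transducers
   indexed by an arbitrary, possibly large, set K has a pointwise product living on functions
   with domain K.  A sub-2-transducer of this product with only a small number of objects, arrows and
   table entries can be transported along an injection into the universe.

   For a limit take K to be the objects of the diagram and the compatible families.  For a colimit take K
   to be the class of all cocones under the diagram and the sub-2-transducer of the product of
   their vertices generated by the images of the diagram: its projections are the mediating
   morphisms, and they are unique because the images of the diagram generate.  It is small because
   a closure of a small set under composition and under the action of a small category is small.

   The cartesian lift of F : P -> Q at (Q, t) is (P, t(-, F -, F -, -)) with identity components. *)
theory Submission
  imports Defs
begin

text \<open>The usual route to colimits is awkward here: in Cat they require quotients and freely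
  added composites, and moving tables along the legs requires left Kan extensions. The route through
  all cocones is the adjoint functor argument for an initial cocone, with smallness of the generated
  part in place of a solution set. It is impredicative, since the cocones include the colimit cocone
  under construction. Nothing is circular: families indexed by cocones are ordinary HOL functions,
  the full product is never made into an object of \<open>TDX\<close>, and only the generated part
  is re-encoded in the universe. The quotient is implicit, as two items are identified as soon as
  every cocone identifies them. Equalities in the result are therefore always checked after all
  projections. The delicate point is that table entries can be compared only at a common index (a,
  p, p', b): equality of functors or of indices has to be settled before equality of
  entries.\<close>

section \<open>Essentially small sets\<close>

text \<open>\<open>small\<close> applies only to sets of elements of the universe, but lists,
  tuples, functions and families indexed by cocones live in other types. Covering by an image of
  \<open>elts x\<close> makes closure under subsets and images immediate. The token \<open>V\<close>
  names the universe, which the type of \<open>X\<close> does not determine.\<close>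

definition esmall :: "'v::zfc_universe itself \<Rightarrow> 'a set \<Rightarrow> bool" where
  "esmall V X \<longleftrightarrow> (\<exists>(x::'v) f. X \<subseteq> f ` elts x)"

lemma esmallI: "X \<subseteq> f ` elts (x::'v::zfc_universe) \<Longrightarrow> esmall TYPE('v) X"
  unfolding esmall_def by blast

lemma esmall_elts: "esmall TYPE('v) (elts (x::'v::zfc_universe))"
  by (rule esmallI[of _ id]) auto

lemma small_esmall: "small (X::'v::zfc_universe set) \<Longrightarrow> esmall TYPE('v) X"
  unfolding small_def by (auto intro: esmall_elts)

lemma esmall_subset: "esmall V Y \<Longrightarrow> X \<subseteq> Y \<Longrightarrow> esmall V X"
  unfolding esmall_def by blast

lemma esmall_image: "esmall V X \<Longrightarrow> esmall V (f ` X)"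
  unfolding esmall_def by (metis image_image image_mono)

text \<open>The infinity axiom doubles as an axiom of pairing, because {a, b} is the range of a
  sequence with two values. Kuratowski pairs then do the rest.\<close>

lemma universe_pairing: "\<exists>pr :: 'v \<Rightarrow> 'v \<Rightarrow> 'v::zfc_universe. \<forall>a b c d. pr a b = pr c d \<longrightarrow> a = c \<and> b = d"
proof -
  have "\<exists>z. elts z = {a, b}" for a b :: 'v
  proof -
    have "{a, b} = range (\<lambda>n::nat. if n = 0 then a else b)" by auto
    then show ?thesis using elts_infinity by (metis imageE)
  qed
  then obtain s :: "'v \<Rightarrow> 'v \<Rightarrow> 'v" where s: "\<And>a b. elts (s a b) = {a, b}" by metis
  have "a = c \<and> b = d" if "s (s a a) (s a b) = s (s c c) (s c d)" for a b c d
    using that s by (metis doubleton_eq_iff)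
  then show ?thesis by (intro exI[of _ "\<lambda>a b. s (s a a) (s a b)"]) blast
qed

text \<open>Replacement gives the set of pair codes over each code of a first coordinate, and then
  the set of these sets; its union \<open>u\<close> covers \<open>Sigma X Y\<close>. The bounds on
  the fibres are selected by choice.\<close>

lemma esmall_Sigma:
  assumes X: "esmall TYPE('v::zfc_universe) X" and Y: "\<And>a. a \<in> X \<Longrightarrow> esmall TYPE('v) (Y a)"
  shows "esmall TYPE('v) (Sigma X Y)"
proof -
  obtain x :: 'v and f where f: "X \<subseteq> f ` elts x" using X unfolding esmall_def by blast
  have "\<forall>a\<in>X. \<exists>(y::'v) g. Y a \<subseteq> g ` elts y" using Y unfolding esmall_def by blast
  then obtain y :: "_ \<Rightarrow> 'v" and g where g: "\<And>a. a \<in> X \<Longrightarrow> Y a \<subseteq> g a ` elts (y a)" by metis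
  obtain pr :: "'v \<Rightarrow> 'v \<Rightarrow> 'v" where pr: "\<And>a b c d. pr a b = pr c d \<Longrightarrow> a = c \<and> b = d"
    using universe_pairing by blast
  define p1 where "p1 w = (SOME a. \<exists>b. w = pr a b)" for w
  define p2 where "p2 w = (SOME b. \<exists>a. w = pr a b)" for w
  have p: "p1 (pr a b) = a" "p2 (pr a b) = b" for a b
    unfolding p1_def p2_def by (rule some_equality; use pr in blast)+
  have "\<forall>a. \<exists>z. elts z = pr a ` elts (y (f a))" using elts_replacement by (metis imageE)
  then obtain z where z: "\<And>a. elts (z a) = pr a ` elts (y (f a))" by metis
  obtain w where w: "elts w = z ` elts x" using elts_replacement by (metis imageE)
  obtain u where u: "elts u = \<Union> (elts ` elts w)" using elts_Union by (metis imageE)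
  show ?thesis
  proof (rule esmallI[of _ "\<lambda>c. (f (p1 c), g (f (p1 c)) (p2 c))" u], rule subsetI)
    fix c assume "c \<in> Sigma X Y"
    then obtain a b where c: "c = (a, b)" "a \<in> X" "b \<in> Y a" by blast
    then obtain a' where a': "a = f a'" "a' \<in> elts x" using f by blast
    obtain b' where b': "b = g a b'" "b' \<in> elts (y a)" using c g by blast
    have "pr a' b' \<in> elts u" using a' b' by (auto simp: u w z)
    then show "c \<in> (\<lambda>c. (f (p1 c), g (f (p1 c)) (p2 c))) ` elts u"
      by (rule rev_image_eqI) (use a' b' c in \<open>simp add: p\<close>)
  qed
qed

lemma esmall_Times: "esmall TYPE('v::zfc_universe) X \<Longrightarrow> esmall TYPE('v) Y \<Longrightarrow> esmall TYPE('v) (X \<times> Y)"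
  by (rule esmall_Sigma)

lemma esmall_UN:
  assumes "esmall TYPE('v::zfc_universe) X" "\<And>a. a \<in> X \<Longrightarrow> esmall TYPE('v) (Y a)"
  shows "esmall TYPE('v) (\<Union>a\<in>X. Y a)"
  by (rule esmall_subset[OF esmall_image[OF esmall_Sigma[OF assms], where f = snd]]) force+

text \<open>A finite universe would be the range of a sequence, hence the extension of one of its
  elements, which would then be a member of itself. So the naturals inject into the universe, and
  the image is the extension of an element.\<close>

lemma esmall_nat: "esmall TYPE('v::zfc_universe) (X :: nat set)"
proof -
  have "infinite (UNIV :: 'v set)"
  proof
    assume "finite (UNIV :: 'v set)"
    then obtain g :: "nat \<Rightarrow> 'v" where "range g = UNIV"
      using finite_imp_nat_seg_image_inj_on[of "UNIV :: 'v set"]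
      by (metis UNIV_I subsetI subset_antisym image_mono)
    then obtain x :: 'v where "elts x = UNIV" using elts_infinity[of g] by auto
    then have "x \<in> elts x" by simp
    then show False using elts_foundation[where 'a = 'v] by (metis (mono_tags) case_prodI mem_Collect_eq wf_irrefl)
  qed
  then obtain g :: "nat \<Rightarrow> 'v" where g: "inj g" using infinite_countable_subset by blast
  obtain x where x: "elts x = range g" using elts_infinity by (metis imageE)
  show ?thesis by (rule esmallI[of _ "inv g" x]) (use g x in \<open>auto simp: image_image inv_f_f\<close>)
qed

lemma esmall_Un:
  assumes "esmall TYPE('v::zfc_universe) X" "esmall TYPE('v) Y" shows "esmall TYPE('v) (X \<union> Y)"
proof -
  have "X \<union> Y = (\<Union>n\<in>{0, 1::nat}. if n = 0 then X else Y)" by auto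
  moreover have "esmall TYPE('v) (\<Union>n\<in>{0, 1::nat}. if n = 0 then X else Y)"
    by (rule esmall_UN[OF esmall_nat]) (simp add: assms)
  ultimately show ?thesis by simp
qed

lemma esmall_iterate:
  assumes "\<And>n::nat. esmall TYPE('v::zfc_universe) (S n)" "X \<subseteq> (\<Union>n. S n)"
  shows "esmall TYPE('v) X"
  by (rule esmall_subset[OF esmall_UN[OF esmall_nat]]) (use assms in auto)

lemma esmall_lists:
  assumes "esmall TYPE('v::zfc_universe) X" shows "esmall TYPE('v) (lists X)"
proof (rule esmall_iterate)
  fix n
  show "esmall TYPE('v) {xs \<in> lists X. length xs = n}"
  proof (induction n)
    case 0
    have "{xs \<in> lists X. length xs = 0} \<subseteq> (\<lambda>n::nat. []) ` UNIV" by auto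
    then show ?case by (rule esmall_subset[OF esmall_image[OF esmall_nat]])
  next
    case (Suc n)
    have "{xs \<in> lists X. length xs = Suc n} \<subseteq> (\<lambda>(x, xs). x # xs) ` (X \<times> {xs \<in> lists X. length xs = n})"
      by (auto simp: length_Suc_conv)
    then show ?case by (rule esmall_subset[OF esmall_image[OF esmall_Times[OF assms Suc]]])
  qed
qed auto

text \<open>Every subset of a covered set is the image of a subset of the covering
  \<open>elts x\<close>. Separation makes that subset an element, and the power axiom collects these
  elements.\<close>

lemma esmall_Pow:
  assumes "esmall TYPE('v::zfc_universe) X" shows "esmall TYPE('v) (Pow X)"
proof -
  obtain x :: 'v and f where f: "X \<subseteq> f ` elts x" using assms unfolding esmall_def by blast
  obtain p where p: "elts p = {y. elts y \<subseteq> elts x}" using elts_power by (metis imageE)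
  show ?thesis
  proof (rule esmallI[of _ "\<lambda>y. f ` elts y" p], rule subsetI)
    fix Y assume "Y \<in> Pow X"
    then obtain Z where Z: "Z \<subseteq> elts x" "Y = f ` Z" using f by (metis PowD order_trans subset_imageE)
    then obtain z where "elts z = Z" using elts_separation by (metis imageE)
    then show "Y \<in> (\<lambda>y. f ` elts y) ` elts p" using Z p by blast
  qed
qed

text \<open>A function in \<open>Pi\<^sub>E I X\<close> is determined by its graph, a subset of
  \<open>Sigma I X\<close>, since extensionality fixes the values off \<open>I\<close>. Reading
  functions off graphs by choice exhibits the function space inside an image of a power set.\<close>

lemma esmall_PiE:
  assumes "esmall TYPE('v::zfc_universe) I" "\<And>i. i \<in> I \<Longrightarrow> esmall TYPE('v) (X i)"
  shows "esmall TYPE('v) (Pi\<^sub>E I X)"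
proof (rule esmall_subset[OF esmall_image[OF esmall_Pow[OF esmall_Sigma[OF assms]]]], assumption)
  show "Pi\<^sub>E I X \<subseteq> (\<lambda>r. \<lambda>i\<in>I. SOME a. (i, a) \<in> r) ` Pow (Sigma I X)"
  proof
    fix h assume h: "h \<in> Pi\<^sub>E I X"
    have "h = (\<lambda>i\<in>I. SOME a. (i, a) \<in> (\<lambda>i. (i, h i)) ` I)"
    proof
      fix i show "h i = (\<lambda>i\<in>I. SOME a. (i, a) \<in> (\<lambda>i. (i, h i)) ` I) i"
        using h by (cases "i \<in> I") (auto intro!: some_equality[symmetric] simp: PiE_def extensional_def)
    qed
    moreover have "(\<lambda>i. (i, h i)) ` I \<in> Pow (Sigma I X)" using h by auto
    ultimately show "h \<in> (\<lambda>r. \<lambda>i\<in>I. SOME a. (i, a) \<in> r) ` Pow (Sigma I X)" by blast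
  qed
qed

text \<open>Choosing preimages injects \<open>X\<close> into the covering \<open>elts x\<close>, and
  separation turns the image into an element. This is how a collection of arbitrary type is brought
  back into the universe.\<close>

lemma esmall_encode:
  assumes "esmall TYPE('v::zfc_universe) X"
  obtains x :: "'v::zfc_universe" and d where "bij_betw d (elts x) X"
proof -
  obtain x :: 'v and f where f: "X \<subseteq> f ` elts x" using assms unfolding esmall_def by blast
  have 1: "inj_on (inv_into (elts x) f) X" using f by (rule inj_on_inv_into)
  have "inv_into (elts x) f ` X \<subseteq> elts x" using f by (auto intro: inv_into_into)
  then obtain y where y: "elts y = inv_into (elts x) f ` X" using elts_separation by (metis imageE)
  have "bij_betw (inv_into X (inv_into (elts x) f)) (elts y) X"
    unfolding y by (rule bij_betw_inv_into) (use 1 in \<open>simp add: bij_betw_def\<close>)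
  then show ?thesis using that by blast
qed

section \<open>Basic rules for categories and functors, and the categories Cat and Set\<close>

section \<open>Elementary category theory\<close>

lemma HomD: "f \<in> Hom C x y \<Longrightarrow> f \<in> Arr C \<and> Dom C f = x \<and> Cod C f = y"
  by (simp add: Hom_def)

lemma category_Dom: "category C \<Longrightarrow> f \<in> Arr C \<Longrightarrow> Dom C f \<in> Obj C"
  and category_Cod: "category C \<Longrightarrow> f \<in> Arr C \<Longrightarrow> Cod C f \<in> Obj C"
  and category_Ident: "category C \<Longrightarrow> x \<in> Obj C \<Longrightarrow> Ident C x \<in> Arr C"
  and category_Dom_Ident: "category C \<Longrightarrow> x \<in> Obj C \<Longrightarrow> Dom C (Ident C x) = x"
  and category_Cod_Ident: "category C \<Longrightarrow> x \<in> Obj C \<Longrightarrow> Cod C (Ident C x) = x"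
  and category_Comp: "category C \<Longrightarrow> f \<in> Arr C \<Longrightarrow> g \<in> Arr C \<Longrightarrow> Dom C g = Cod C f \<Longrightarrow> Comp C g f \<in> Arr C"
  and category_Dom_Comp: "category C \<Longrightarrow> f \<in> Arr C \<Longrightarrow> g \<in> Arr C \<Longrightarrow> Dom C g = Cod C f \<Longrightarrow> Dom C (Comp C g f) = Dom C f"
  and category_Cod_Comp: "category C \<Longrightarrow> f \<in> Arr C \<Longrightarrow> g \<in> Arr C \<Longrightarrow> Dom C g = Cod C f \<Longrightarrow> Cod C (Comp C g f) = Cod C g"
  and category_Comp_Ident: "category C \<Longrightarrow> f \<in> Arr C \<Longrightarrow> Comp C f (Ident C (Dom C f)) = f"
  and category_Ident_Comp: "category C \<Longrightarrow> f \<in> Arr C \<Longrightarrow> Comp C (Ident C (Cod C f)) f = f"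
  and category_assoc: "category C \<Longrightarrow> f \<in> Arr C \<Longrightarrow> g \<in> Arr C \<Longrightarrow> h \<in> Arr C \<Longrightarrow> Dom C g = Cod C f \<Longrightarrow>
     Dom C h = Cod C g \<Longrightarrow> Comp C h (Comp C g f) = Comp C (Comp C h g) f"
  unfolding category_def Hom_def by blast+

lemmas category_simps = category_Dom category_Cod category_Ident category_Dom_Ident category_Cod_Ident
  category_Comp category_Dom_Comp category_Cod_Comp category_Comp_Ident category_Ident_Comp

lemma category_op_cat: "category C \<Longrightarrow> category (op_cat C)"
  unfolding category_def op_cat_def Hom_def by (auto; metis)

lemma category_prod_cat: "category C \<Longrightarrow> category D \<Longrightarrow> category (C \<times>\<^sub>C D)"
  by (subst category_def) (auto simp: prod_cat_def Hom_def category_simps category_assoc)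

lemma category_free_monoidal:
  assumes C: "category C" shows "category (free_monoidal C)"
proof -
  have mem: "f \<in> lists (Arr C) \<Longrightarrow> i < length f \<Longrightarrow> f ! i \<in> Arr C" for f i by (auto simp: in_lists_conv_set)
  have memo: "f \<in> lists (Obj C) \<Longrightarrow> i < length f \<Longrightarrow> f ! i \<in> Obj C" for f i by (auto simp: in_lists_conv_set)
  \<comment> \<open>\<open>map2\<close> silently truncates, so composability must also yield equal
    lengths; equality of the mapped lists gives both.\<close>
  have comp: "length g = length f \<and> (\<forall>i<length f. Dom C (g!i) = Cod C (f!i))" if "map (Dom C) g = map (Cod C) f" for f g
    using that by (metis length_map nth_map)
  show ?thesis
    unfolding category_def free_monoidal_def Hom_def
    apply (simp, intro conjI ballI impI)
    subgoal using C by (auto simp: category_simps)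
    subgoal using C by (auto simp: category_simps)
    subgoal using C by (auto simp: category_simps)
    subgoal using C by (auto simp: category_simps intro!: nth_equalityI dest!: memo)
    subgoal using C by (auto simp: category_simps intro!: nth_equalityI dest!: memo)
    subgoal for f g using C comp[of g f]
      by (auto simp: in_lists_conv_set set_zip category_simps)
    subgoal for f g using C comp[of g f] mem
      by (intro nth_equalityI) (auto simp: category_simps)
    subgoal for f g using C comp[of g f] mem
      by (intro nth_equalityI) (auto simp: category_simps)
    subgoal for f using C mem
      by (intro nth_equalityI) (auto simp: category_simps)
    subgoal for f using C mem
      by (intro nth_equalityI) (auto simp: category_simps)
    subgoal for f g h using C mem comp[of g f] comp[of h g]
      by (intro nth_equalityI) (auto simp: category_assoc)
    done
qed

lemma category_tdx_base: "category A \<Longrightarrow> category B \<Longrightarrow> category Q \<Longrightarrow> category (tdx_base A B Q)"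
  unfolding tdx_base_def by (intro category_prod_cat category_op_cat category_free_monoidal)

lemma is_functorI:
  assumes "category C" "category D" "OMap F \<in> extensional (Obj C)" "AMap F \<in> extensional (Arr C)"
    "\<And>x. x \<in> Obj C \<Longrightarrow> OMap F x \<in> Obj D"
    "\<And>f. f \<in> Arr C \<Longrightarrow> AMap F f \<in> Arr D"
    "\<And>f. f \<in> Arr C \<Longrightarrow> Dom D (AMap F f) = OMap F (Dom C f)"
    "\<And>f. f \<in> Arr C \<Longrightarrow> Cod D (AMap F f) = OMap F (Cod C f)"
    "\<And>x. x \<in> Obj C \<Longrightarrow> AMap F (Ident C x) = Ident D (OMap F x)"
    "\<And>f g. f \<in> Arr C \<Longrightarrow> g \<in> Arr C \<Longrightarrow> Dom C g = Cod C f \<Longrightarrow>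
        AMap F (Comp C g f) = Comp D (AMap F g) (AMap F f)"
  shows "is_functor C D F"
  using assms unfolding is_functor_def PiE_def by auto

lemma functor_category: "is_functor C D F \<Longrightarrow> category C" "is_functor C D F \<Longrightarrow> category D"
  and functor_OMap: "is_functor C D F \<Longrightarrow> x \<in> Obj C \<Longrightarrow> OMap F x \<in> Obj D"
  and functor_AMap: "is_functor C D F \<Longrightarrow> f \<in> Arr C \<Longrightarrow> AMap F f \<in> Arr D"
  and functor_Dom: "is_functor C D F \<Longrightarrow> f \<in> Arr C \<Longrightarrow> Dom D (AMap F f) = OMap F (Dom C f)"
  and functor_Cod: "is_functor C D F \<Longrightarrow> f \<in> Arr C \<Longrightarrow> Cod D (AMap F f) = OMap F (Cod C f)"
  and functor_Ident: "is_functor C D F \<Longrightarrow> x \<in> Obj C \<Longrightarrow> AMap F (Ident C x) = Ident D (OMap F x)"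
  and functor_Comp: "is_functor C D F \<Longrightarrow> f \<in> Arr C \<Longrightarrow> g \<in> Arr C \<Longrightarrow> Dom C g = Cod C f \<Longrightarrow>
        AMap F (Comp C g f) = Comp D (AMap F g) (AMap F f)"
  and functor_OMap_extensional: "is_functor C D F \<Longrightarrow> OMap F \<in> extensional (Obj C)"
  and functor_AMap_extensional: "is_functor C D F \<Longrightarrow> AMap F \<in> extensional (Arr C)"
  unfolding is_functor_def PiE_def by auto

lemmas functor_simps = functor_OMap functor_AMap functor_Dom functor_Cod functor_Ident functor_Comp

lemma functor_eqI:
  assumes "is_functor C D F" "is_functor C D' G"
    "\<And>x. x \<in> Obj C \<Longrightarrow> OMap F x = OMap G x" "\<And>f. f \<in> Arr C \<Longrightarrow> AMap F f = AMap G f"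
  shows "F = G"
proof -
  have "OMap F = OMap G" "AMap F = AMap G"
    using assms by (auto intro!: extensionalityI functor_OMap_extensional functor_AMap_extensional)
  then show ?thesis by simp
qed

lemma is_functor_id: "category C \<Longrightarrow> is_functor C C (id_functor C)"
  unfolding id_functor_def by (rule is_functorI) (auto simp: category_simps)

lemma is_functor_comp:
  "is_functor C D F \<Longrightarrow> is_functor D E G \<Longrightarrow> is_functor C E (comp_functor C G F)"
  unfolding comp_functor_def
  by (rule is_functorI) (auto simp: compose_def category_simps functor_simps functor_category)

lemma OMap_comp_functor: "x \<in> Obj C \<Longrightarrow> OMap (comp_functor C G F) x = OMap G (OMap F x)"
  and AMap_comp_functor: "f \<in> Arr C \<Longrightarrow> AMap (comp_functor C G F) f = AMap G (AMap F f)"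
  and OMap_id_functor: "x \<in> Obj C \<Longrightarrow> OMap (id_functor C) x = x"
  and AMap_id_functor: "f \<in> Arr C \<Longrightarrow> AMap (id_functor C) f = f"
  by (auto simp: comp_functor_def compose_def id_functor_def)

lemmas comp_functor_simps = OMap_comp_functor AMap_comp_functor OMap_id_functor AMap_id_functor

lemma comp_functor_id:
  assumes "is_functor C D F" shows "comp_functor C F (id_functor C) = F"
  by (rule functor_eqI[of C D _ D])
    (use assms in \<open>auto intro: is_functor_comp is_functor_id functor_category simp: comp_functor_simps\<close>)

lemma id_comp_functor:
  assumes "is_functor C D F" shows "comp_functor C (id_functor D) F = F"
  by (rule functor_eqI[of C D _ D])
    (use assms in \<open>auto intro: is_functor_comp is_functor_id functor_category simp: comp_functor_simps functor_simps\<close>)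

lemma comp_functor_assoc:
  assumes "is_functor C D F" "is_functor D E G" "is_functor E E' H"
  shows "comp_functor C H (comp_functor C G F) = comp_functor C (comp_functor D H G) F"
  by (rule functor_eqI[of C E' _ E'])
    (use assms in \<open>auto intro: is_functor_comp simp: comp_functor_simps functor_simps\<close>)

lemma category_Cat: "category (Cat :: ('v::zfc_universe cat, 'v cat_arrow) category)"
  unfolding category_def Cat_def Hom_def
  by (auto simp: small_category_def comp_functor_id id_comp_functor is_functor_id is_functor_comp
      intro: comp_functor_assoc)

lemma category_Set_cat: "category (Set_cat :: ('v::zfc_universe, 'v set_arrow) category)"
  unfolding category_def Set_cat_def Hom_def
  by (auto simp: compose_def PiE_iff restrict_def extensional_def fun_eq_iff)

section \<open>Functors to sets as actions on elements\<close>

section \<open>Set-valued functors\<close>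

text \<open>The ends of an arrow of \<open>Set_cat\<close> are already known from
  \<open>OMap\<close>. Keeping only the middle component lets the functor laws be used as equations
  between elements, free of restrictions and of \<open>Comp Set_cat\<close>.\<close>

definition act :: "('o, 'm, 'v, 'v set_arrow) functor_maps \<Rightarrow> 'm \<Rightarrow> 'v \<Rightarrow> 'v" where
  "act t u = fst (snd (AMap t u))"

lemma set_functor_AMap:
  assumes "is_functor C (Set_cat :: ('v::zfc_universe, 'v set_arrow) category) t" "u \<in> Arr C"
  shows "AMap t u = (OMap t (Dom C u), act t u, OMap t (Cod C u))"
    and "act t u \<in> elts (OMap t (Dom C u)) \<rightarrow>\<^sub>E elts (OMap t (Cod C u))"
  using functor_AMap[OF assms] functor_Dom[OF assms] functor_Cod[OF assms]
  by (auto simp: Set_cat_def act_def)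

lemma act_closed:
  assumes "is_functor C (Set_cat :: ('v::zfc_universe, 'v set_arrow) category) t" "u \<in> Arr C"
    "z \<in> elts (OMap t (Dom C u))"
  shows "act t u z \<in> elts (OMap t (Cod C u))"
  using set_functor_AMap(2)[OF assms(1,2)] assms(3) by auto

lemma act_Ident:
  assumes "is_functor C (Set_cat :: ('v::zfc_universe, 'v set_arrow) category) t" "x \<in> Obj C"
    "z \<in> elts (OMap t x)"
  shows "act t (Ident C x) z = z"
  using functor_Ident[OF assms(1,2)] assms(3) by (simp add: act_def Set_cat_def)

lemma act_Comp:
  assumes t: "is_functor C (Set_cat :: ('v::zfc_universe, 'v set_arrow) category) t"
    and uw: "u \<in> Arr C" "w \<in> Arr C" "Dom C w = Cod C u" and z: "z \<in> elts (OMap t (Dom C u))"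
  shows "act t (Comp C w u) z = act t w (act t u z)"
proof -
  have "AMap t (Comp C w u) = Comp Set_cat (OMap t (Dom C w), act t w, OMap t (Cod C w))
      (OMap t (Dom C u), act t u, OMap t (Cod C u))"
    using functor_Comp[OF t uw] by (simp add: set_functor_AMap[OF t] uw)
  then show ?thesis using z by (simp add: act_def Set_cat_def compose_def)
qed

text \<open>The restrictions discard whatever \<open>T\<close> and \<open>a\<close> do off their
  intended domains, so an action obtained by choice can be inserted directly and only its behaviour
  on elements has to be checked.\<close>

definition set_functor ::
  "('o, 'm) category \<Rightarrow> ('o \<Rightarrow> 'v::zfc_universe) \<Rightarrow> ('m \<Rightarrow> 'v \<Rightarrow> 'v) \<Rightarrow> ('o, 'm, 'v, 'v set_arrow) functor_maps" where
  "set_functor C T a = \<lparr>OMap = restrict T (Obj C),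
     AMap = (\<lambda>u\<in>Arr C. (T (Dom C u), restrict (a u) (elts (T (Dom C u))), T (Cod C u)))\<rparr>"

lemma is_functor_set_functor:
  assumes C: "category C"
    and cl: "\<And>u z. u \<in> Arr C \<Longrightarrow> z \<in> elts (T (Dom C u)) \<Longrightarrow> a u z \<in> elts (T (Cod C u))"
    and id: "\<And>x z. x \<in> Obj C \<Longrightarrow> z \<in> elts (T x) \<Longrightarrow> a (Ident C x) z = z"
    and cm: "\<And>u w z. u \<in> Arr C \<Longrightarrow> w \<in> Arr C \<Longrightarrow> Dom C w = Cod C u \<Longrightarrow> z \<in> elts (T (Dom C u)) \<Longrightarrow>
      a (Comp C w u) z = a w (a u z)"
  shows "is_functor C Set_cat (set_functor C T a)"
proof (rule is_functorI)
  show "AMap (set_functor C T a) (Ident C x) = Ident Set_cat (OMap (set_functor C T a) x)"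
    if "x \<in> Obj C" for x
    using that C id by (auto simp: set_functor_def Set_cat_def category_simps restrict_def)
  show "AMap (set_functor C T a) (Comp C g f) =
      Comp Set_cat (AMap (set_functor C T a) g) (AMap (set_functor C T a) f)"
    if "f \<in> Arr C" "g \<in> Arr C" "Dom C g = Cod C f" for f g
    using that C cl[of f] cm[of f g] by (auto simp: set_functor_def Set_cat_def category_simps compose_def)
qed (use C cl in \<open>auto simp: set_functor_def Set_cat_def category_simps category_Set_cat[unfolded Set_cat_def]\<close>)

lemma OMap_set_functor: "x \<in> Obj C \<Longrightarrow> OMap (set_functor C T a) x = T x"
  and act_set_functor: "u \<in> Arr C \<Longrightarrow> z \<in> elts (T (Dom C u)) \<Longrightarrow> act (set_functor C T a) u z = a u z"
  by (auto simp: set_functor_def act_def)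

lemma act_comp_functor: "u \<in> Arr C \<Longrightarrow> act (comp_functor C t F) u = act t (AMap F u)"
  by (simp add: act_def AMap_comp_functor)

section \<open>Functoriality of the passage from functors of states to functors of table
  indices\<close>

section \<open>Change of base\<close>

lemma is_functor_op_cat:
  assumes "is_functor C D F" shows "is_functor (op_cat C) (op_cat D) F"
proof (rule is_functorI)
  show "category (op_cat C)" "category (op_cat D)"
    using assms by (auto intro: category_op_cat functor_category)
qed (use assms in \<open>auto simp: op_cat_def functor_simps intro: functor_OMap_extensional functor_AMap_extensional\<close>)

lemma is_functor_prod_functor:
  assumes "is_functor C C' F" "is_functor D D' G"
  shows "is_functor (C \<times>\<^sub>C D) (C' \<times>\<^sub>C D') (prod_functor C D F G)"
proof (rule is_functorI)
  show "category (C \<times>\<^sub>C D)" "category (C' \<times>\<^sub>C D')"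
    using assms by (auto intro: category_prod_cat functor_category)
qed (use assms in \<open>auto simp: prod_cat_def prod_functor_def functor_simps category_simps
      functor_category[OF assms(1)] functor_category[OF assms(2)]\<close>)

lemma prod_functor_id: "prod_functor C D (id_functor C) (id_functor D) = id_functor (C \<times>\<^sub>C D)"
  by (auto simp: prod_functor_def id_functor_def prod_cat_def restrict_def)

lemma prod_functor_comp:
  assumes "is_functor C C' F" "is_functor D D' G"
  shows "prod_functor C D (comp_functor C F' F) (comp_functor D G' G) =
    comp_functor (C \<times>\<^sub>C D) (prod_functor C' D' F' G') (prod_functor C D F G)"
  using assms by (auto simp: prod_functor_def comp_functor_def compose_def prod_cat_def restrict_def
      functor_simps fun_eq_iff)

lemma id_functor_op_cat: "id_functor (op_cat C) = id_functor C"
  and comp_functor_op_cat: "comp_functor (op_cat C) G F = comp_functor C G F"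
  by (simp_all add: id_functor_def comp_functor_def op_cat_def)

locale transducers =
  fixes A B :: "('v::zfc_universe, 'v) category"
  assumes small_A: "small_category A" and small_B: "small_category B"
begin

abbreviation "base \<equiv> tdx_base A B"
abbreviation "lift \<equiv> tdx_base_functor A B"
abbreviation "T \<equiv> TDX A B"

lemma category_A: "category A" and category_B: "category B"
  using small_A small_B by (auto simp: small_category_def)

lemma category_base: "category Q \<Longrightarrow> category (base Q)"
  by (rule category_tdx_base[OF category_A category_B])

lemma is_functor_lift:
  assumes "is_functor P Q F" shows "is_functor (base P) (base Q) (lift P F)"
  unfolding tdx_base_def tdx_base_functor_def Let_def
  using assms category_A category_B
  by (intro is_functor_prod_functor is_functor_id is_functor_op_cat category_op_cat category_free_monoidal)

lemma lift_id: "lift Q (id_functor Q) = id_functor (base Q)"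
proof -
  let ?M = "op_cat (free_monoidal B)"
  \<comment> \<open>The contravariant factor carries the same maps; writing its identity as one on
    \<open>op_cat Q\<close> lets the product law apply at every level.\<close>
  have "lift Q (id_functor Q) = prod_functor A (op_cat Q \<times>\<^sub>C Q \<times>\<^sub>C ?M) (id_functor A)
        (prod_functor (op_cat Q) (Q \<times>\<^sub>C ?M) (id_functor (op_cat Q)) (prod_functor Q ?M (id_functor Q) (id_functor ?M)))"
    by (simp only: tdx_base_functor_def Let_def id_functor_op_cat[of Q])
  then show ?thesis by (simp only: prod_functor_id tdx_base_def)
qed

lemma lift_comp:
  assumes "is_functor P Q F" "is_functor Q R G"
  shows "lift P (comp_functor P G F) = comp_functor (base P) (lift Q G) (lift P F)"
proof -
  let ?M = "op_cat (free_monoidal B)"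
  have M: "is_functor ?M ?M (id_functor ?M)"
    by (intro is_functor_id category_op_cat category_free_monoidal category_B)
  have A: "is_functor A A (id_functor A)" by (intro is_functor_id category_A)
  note 1 = is_functor_prod_functor[OF assms(1) M]
  note 2 = is_functor_prod_functor[OF is_functor_op_cat[OF assms(1)] 1]
  \<comment> \<open>The identities on \<open>A\<close> and \<open>?M\<close> are split into
    composites of two identities, so that \<open>prod_functor_comp\<close> applies to every
    factor.\<close>
  have "lift P (comp_functor P G F) =
    prod_functor A (op_cat P \<times>\<^sub>C P \<times>\<^sub>C ?M) (comp_functor A (id_functor A) (id_functor A))
        (prod_functor (op_cat P) (P \<times>\<^sub>C ?M) (comp_functor (op_cat P) G F)
          (prod_functor P ?M (comp_functor P G F) (comp_functor ?M (id_functor ?M) (id_functor ?M))))"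
    unfolding tdx_base_functor_def Let_def
    by (simp only: comp_functor_op_cat[of P] comp_functor_id[OF A] comp_functor_id[OF M])
  also have "\<dots> = comp_functor (base P) (lift Q G) (lift P F)"
    by (simp only: tdx_base_def tdx_base_functor_def Let_def prod_functor_comp[OF assms(1) M]
        prod_functor_comp[OF is_functor_op_cat[OF assms(1)] 1] prod_functor_comp[OF A 2])
  finally show ?thesis .
qed

lemma esmall_base:
  assumes "small_category Q"
  shows "esmall TYPE('v) (Obj (base Q))" "esmall TYPE('v) (Arr (base Q))"
  using assms small_A small_B
  unfolding small_category_def tdx_base_def prod_cat_def op_cat_def free_monoidal_def
  by (auto intro!: esmall_Times esmall_lists small_esmall)

section \<open>Morphisms as a functor together with maps of entries, and the category laws\<close>

section \<open>Morphisms of transducers, elementwise\<close>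

definition arr_functor :: "'v tdx_arrow \<Rightarrow> 'v cat_functor" where
  "arr_functor f = fst (fst (snd f))"

definition arr_map :: "'v tdx_arrow \<Rightarrow> 'v tdx_index \<Rightarrow> 'v \<Rightarrow> 'v" where
  "arr_map f x = fst (snd (snd (fst (snd f)) x))"

text \<open>The index bookkeeping of a morphism: an entry of the source at \<open>x\<close> is sent
  to the target table at \<open>OMap (arr_lift f) x\<close>.\<close>

definition arr_lift :: "'v tdx_arrow \<Rightarrow> ('v tdx_index, 'v tdx_index, 'v tdx_index, 'v tdx_index) functor_maps" where
  "arr_lift f = lift (fst (fst f)) (arr_functor f)"

lemma tdx_objD:
  assumes "X \<in> Obj T"
  shows "fst X \<in> Obj Cat" "small_category (fst X)" "category (fst X)" "normalized (fst X)"
    "is_functor (base (fst X)) Set_cat (snd X)"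
  using assms by (auto simp: TDX_def tdx_obj_def Cat_def small_category_def)

lemma tdx_objI: "Q \<in> Obj Cat \<Longrightarrow> is_functor (base Q) Set_cat t \<Longrightarrow> (Q, t) \<in> Obj T"
  by (auto simp: TDX_def tdx_obj_def)

lemma Hom_TDX_iff:
  "f \<in> Hom T X Y \<longleftrightarrow> (\<exists>F \<theta>. f = (X, (F, \<theta>), Y) \<and> X \<in> Obj T \<and> Y \<in> Obj T \<and> is_functor (fst X) (fst Y) F \<and>
     is_nat_trans (base (fst X)) Set_cat (snd X) (comp_functor (base (fst X)) (snd Y) (lift (fst X) F)) \<theta>)"
  by (cases X; cases Y; cases f) (auto simp: Hom_def TDX_def tdx_arr_def)

lemma HomT_E:
  assumes "f \<in> Hom T X Y"
  obtains \<theta> where "f = (X, (arr_functor f, \<theta>), Y)" "X \<in> Obj T" "Y \<in> Obj T"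
    "is_functor (fst X) (fst Y) (arr_functor f)" "arr_lift f = lift (fst X) (arr_functor f)"
    "is_nat_trans (base (fst X)) Set_cat (snd X) (comp_functor (base (fst X)) (snd Y) (arr_lift f)) \<theta>"
    "\<And>x. x \<in> Obj (base (fst X)) \<Longrightarrow>
      \<theta> x = (OMap (snd X) x, arr_map f x, OMap (snd Y) (OMap (arr_lift f) x))"
    "\<And>x. x \<in> Obj (base (fst X)) \<Longrightarrow>
      arr_map f x \<in> elts (OMap (snd X) x) \<rightarrow>\<^sub>E elts (OMap (snd Y) (OMap (arr_lift f) x))"
proof -
  obtain F \<theta> where f: "f = (X, (F, \<theta>), Y)" "X \<in> Obj T" "Y \<in> Obj T" "is_functor (fst X) (fst Y) F"
    and n: "is_nat_trans (base (fst X)) Set_cat (snd X) (comp_functor (base (fst X)) (snd Y) (lift (fst X) F)) \<theta>"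
    using assms unfolding Hom_TDX_iff by blast
  have F: "arr_functor f = F" "arr_lift f = lift (fst X) F"
    by (simp_all add: f(1) arr_functor_def arr_lift_def)
  have t: "\<theta> x = (OMap (snd X) x, arr_map f x, OMap (snd Y) (OMap (arr_lift f) x)) \<and>
      arr_map f x \<in> elts (OMap (snd X) x) \<rightarrow>\<^sub>E elts (OMap (snd Y) (OMap (arr_lift f) x))"
    if "x \<in> Obj (base (fst X))" for x
  proof -
    have "\<theta> x \<in> Hom Set_cat (OMap (snd X) x) (OMap (snd Y) (OMap (lift (fst X) F) x))"
      using n that by (auto simp: is_nat_trans_def OMap_comp_functor)
    then show ?thesis
      by (cases "\<theta> x") (auto simp: Hom_def Set_cat_def f(1) arr_map_def arr_lift_def arr_functor_def)
  qed
  show ?thesis by (rule that[of \<theta>]) (use f(2-4) n t in \<open>simp_all add: F flip: f(1)\<close>)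
qed

lemma HomT_D:
  assumes f: "f \<in> Hom T X Y"
  shows HomT_Dom: "X \<in> Obj T" and HomT_Cod: "Y \<in> Obj T"
    and HomT_functor: "is_functor (fst X) (fst Y) (arr_functor f)"
    and HomT_lift: "is_functor (base (fst X)) (base (fst Y)) (arr_lift f)"
    and HomT_lift_eq: "arr_lift f = lift (fst X) (arr_functor f)"
    and HomT_extensional: "x \<in> Obj (base (fst X)) \<Longrightarrow> arr_map f x \<in> extensional (elts (OMap (snd X) x))"
    and HomT_map: "x \<in> Obj (base (fst X)) \<Longrightarrow> z \<in> elts (OMap (snd X) x) \<Longrightarrow>
      arr_map f x z \<in> elts (OMap (snd Y) (OMap (arr_lift f) x))"
    and HomT_natural: "u \<in> Arr (base (fst X)) \<Longrightarrow> z \<in> elts (OMap (snd X) (Dom (base (fst X)) u)) \<Longrightarrow>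
      arr_map f (Cod (base (fst X)) u) (act (snd X) u z) =
      act (snd Y) (AMap (arr_lift f) u) (arr_map f (Dom (base (fst X)) u) z)"
proof -
  obtain \<theta> where X: "X \<in> Obj T" and Y: "Y \<in> Obj T" and F: "is_functor (fst X) (fst Y) (arr_functor f)"
    and l: "arr_lift f = lift (fst X) (arr_functor f)"
    and n: "is_nat_trans (base (fst X)) Set_cat (snd X) (comp_functor (base (fst X)) (snd Y) (arr_lift f)) \<theta>"
    and t: "\<And>x. x \<in> Obj (base (fst X)) \<Longrightarrow>
      \<theta> x = (OMap (snd X) x, arr_map f x, OMap (snd Y) (OMap (arr_lift f) x))"
    and m: "\<And>x. x \<in> Obj (base (fst X)) \<Longrightarrow>
      arr_map f x \<in> elts (OMap (snd X) x) \<rightarrow>\<^sub>E elts (OMap (snd Y) (OMap (arr_lift f) x))"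
    using HomT_E[OF f] by metis
  show "X \<in> Obj T" "Y \<in> Obj T" "is_functor (fst X) (fst Y) (arr_functor f)"
    "arr_lift f = lift (fst X) (arr_functor f)" by fact+
  show "is_functor (base (fst X)) (base (fst Y)) (arr_lift f)"
    unfolding l by (rule is_functor_lift[OF F])
  show "x \<in> Obj (base (fst X)) \<Longrightarrow> arr_map f x \<in> extensional (elts (OMap (snd X) x))"
    using m[of x] unfolding PiE_def by blast
  show "x \<in> Obj (base (fst X)) \<Longrightarrow> z \<in> elts (OMap (snd X) x) \<Longrightarrow>
      arr_map f x z \<in> elts (OMap (snd Y) (OMap (arr_lift f) x))"
    using m by blast
  assume u: "u \<in> Arr (base (fst X))" and z: "z \<in> elts (OMap (snd X) (Dom (base (fst X)) u))"
  have c: "category (base (fst X))" using X by (simp add: tdx_objD category_base)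
  note du = category_Dom[OF c u] category_Cod[OF c u]
  let ?t = "comp_functor (base (fst X)) (snd Y) (arr_lift f)"
  have tf: "is_functor (base (fst X)) Set_cat ?t"
    and "Comp Set_cat (\<theta> (Cod (base (fst X)) u)) (AMap (snd X) u) =
      Comp Set_cat (AMap ?t u) (\<theta> (Dom (base (fst X)) u))"
    using n u unfolding is_nat_trans_def by blast+
  \<comment> \<open>Both composites of the naturality square are evaluated at the entry
    \<open>z\<close>.\<close>
  from arg_cong[OF this(2), of "\<lambda>w. fst (snd w) z"] show
    "arr_map f (Cod (base (fst X)) u) (act (snd X) u z) =
      act (snd Y) (AMap (arr_lift f) u) (arr_map f (Dom (base (fst X)) u) z)"
    using z u t[OF du(1)] t[OF du(2)] set_functor_AMap(1)[OF tdx_objD(5)[OF X] u] set_functor_AMap(1)[OF tf u]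
    by (simp add: Set_cat_def compose_def act_comp_functor)
qed

text \<open>The endpoints and the functor determine the ends of every component, while
  extensionality fixes each function off its table and the family off the index set. Equations
  between morphisms thereby become equations between entries.\<close>

lemma HomT_eqI:
  assumes f: "f \<in> Hom T X Y" and g: "g \<in> Hom T X Y"
    and F: "arr_functor f = arr_functor g"
    and m: "\<And>x z. x \<in> Obj (base (fst X)) \<Longrightarrow> z \<in> elts (OMap (snd X) x) \<Longrightarrow> arr_map f x z = arr_map g x z"
  shows "f = g"
proof -
  obtain \<theta> where 1: "f = (X, (arr_functor f, \<theta>), Y)"
    "\<theta> \<in> extensional (Obj (base (fst X)))"
    "\<And>x. x \<in> Obj (base (fst X)) \<Longrightarrow> \<theta> x = (OMap (snd X) x, arr_map f x, OMap (snd Y) (OMap (arr_lift f) x))"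
    using HomT_E[OF f] unfolding is_nat_trans_def by metis
  obtain \<eta> where 2: "g = (X, (arr_functor g, \<eta>), Y)"
    "\<eta> \<in> extensional (Obj (base (fst X)))"
    "\<And>x. x \<in> Obj (base (fst X)) \<Longrightarrow> \<eta> x = (OMap (snd X) x, arr_map g x, OMap (snd Y) (OMap (arr_lift g) x))"
    using HomT_E[OF g] unfolding is_nat_trans_def by metis
  have "arr_map f x = arr_map g x" if "x \<in> Obj (base (fst X))" for x
    by (rule extensionalityI[OF HomT_extensional[OF f that] HomT_extensional[OF g that] m[OF that]])
  moreover have "arr_lift f = arr_lift g" by (simp add: HomT_lift_eq[OF f] HomT_lift_eq[OF g] F)
  ultimately have "\<theta> = \<eta>"
    by (intro extensionalityI[OF 1(2) 2(2)]) (simp add: 1(3) 2(3))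
  then show ?thesis using 1(1) 2(1) F by metis
qed

text \<open>The restriction of \<open>m\<close> allows maps that are specified only on entries, in
  particular maps found by choice.\<close>

definition tdx_mk :: "'v tdx \<Rightarrow> 'v cat_functor \<Rightarrow> ('v tdx_index \<Rightarrow> 'v \<Rightarrow> 'v) \<Rightarrow> 'v tdx \<Rightarrow> 'v tdx_arrow" where
  "tdx_mk X F m Y = (X, (F, \<lambda>x\<in>Obj (base (fst X)).
     (OMap (snd X) x, restrict (m x) (elts (OMap (snd X) x)), OMap (snd Y) (OMap (lift (fst X) F) x))), Y)"

lemma arr_functor_mk: "arr_functor (tdx_mk X F m Y) = F"
  and arr_lift_mk: "arr_lift (tdx_mk X F m Y) = lift (fst X) F"
  and arr_map_mk: "x \<in> Obj (base (fst X)) \<Longrightarrow> z \<in> elts (OMap (snd X) x) \<Longrightarrow> arr_map (tdx_mk X F m Y) x z = m x z"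
  by (auto simp: tdx_mk_def arr_functor_def arr_lift_def arr_map_def)

lemma tdx_mk_Hom:
  assumes X: "X \<in> Obj T" and Y: "Y \<in> Obj T" and F: "is_functor (fst X) (fst Y) F"
    and m: "\<And>x z. x \<in> Obj (base (fst X)) \<Longrightarrow> z \<in> elts (OMap (snd X) x) \<Longrightarrow>
      m x z \<in> elts (OMap (snd Y) (OMap (lift (fst X) F) x))"
    and n: "\<And>u z. u \<in> Arr (base (fst X)) \<Longrightarrow> z \<in> elts (OMap (snd X) (Dom (base (fst X)) u)) \<Longrightarrow>
      m (Cod (base (fst X)) u) (act (snd X) u z) =
      act (snd Y) (AMap (lift (fst X) F) u) (m (Dom (base (fst X)) u) z)"
  shows "tdx_mk X F m Y \<in> Hom T X Y"
proof -
  let ?b = "base (fst X)"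
  let ?t = "comp_functor ?b (snd Y) (lift (fst X) F)"
  let ?\<theta> = "\<lambda>x\<in>Obj ?b. (OMap (snd X) x, restrict (m x) (elts (OMap (snd X) x)), OMap (snd Y) (OMap (lift (fst X) F) x))"
  have c: "category ?b" using X by (simp add: tdx_objD category_base)
  have L: "is_functor ?b (base (fst Y)) (lift (fst X) F)" using F by (rule is_functor_lift)
  have t: "is_functor ?b Set_cat ?t" by (rule is_functor_comp[OF L tdx_objD(5)[OF Y]])
  have "Comp Set_cat (?\<theta> (Cod ?b u)) (AMap (snd X) u) = Comp Set_cat (AMap ?t u) (?\<theta> (Dom ?b u))"
    if u: "u \<in> Arr ?b" for u
  proof -
    note du = category_Dom[OF c u] category_Cod[OF c u]
    \<comment> \<open>Composition in \<open>Set_cat\<close> restricts to the source table, so the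
      naturality square is an equality of two restricted functions.\<close>
    have "restrict (\<lambda>z. restrict (m (Cod ?b u)) (elts (OMap (snd X) (Cod ?b u))) (act (snd X) u z)) (elts (OMap (snd X) (Dom ?b u)))
      = restrict (\<lambda>z. act ?t u (restrict (m (Dom ?b u)) (elts (OMap (snd X) (Dom ?b u))) z)) (elts (OMap (snd X) (Dom ?b u)))"
      using n[OF u] act_closed[OF tdx_objD(5)[OF X] u] by (auto simp: restrict_def act_comp_functor[OF u])
    then show ?thesis
      using du u by (simp add: set_functor_AMap[OF tdx_objD(5)[OF X] u] set_functor_AMap[OF t u] Set_cat_def
          compose_def OMap_comp_functor)
  qed
  moreover have "?\<theta> x \<in> Hom Set_cat (OMap (snd X) x) (OMap ?t x)" if "x \<in> Obj ?b" for x
    using m[OF that] that by (auto simp: Hom_def Set_cat_def OMap_comp_functor)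
  ultimately have "is_nat_trans ?b Set_cat (snd X) ?t ?\<theta>"
    unfolding is_nat_trans_def using t tdx_objD(5)[OF X] by auto
  then show ?thesis unfolding Hom_TDX_iff tdx_mk_def using X Y F by blast
qed

text \<open>Brings a composite into the form from which functor and entry maps can be read off;
  \<open>lift_comp\<close> reconciles the two descriptions of the target index.\<close>

lemma Comp_TDX_mk:
  assumes f: "f \<in> Hom T X Y" and g: "g \<in> Hom T Y Z"
  shows "Comp T g f = tdx_mk X (comp_functor (fst X) (arr_functor g) (arr_functor f))
    (\<lambda>x z. arr_map g (OMap (arr_lift f) x) (arr_map f x z)) Z"
proof -
  obtain \<theta> where 1: "f = (X, (arr_functor f, \<theta>), Y)"
    "\<theta> \<in> extensional (Obj (base (fst X)))"
    "\<And>x. x \<in> Obj (base (fst X)) \<Longrightarrow> \<theta> x = (OMap (snd X) x, arr_map f x, OMap (snd Y) (OMap (arr_lift f) x))"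
    using HomT_E[OF f] unfolding is_nat_trans_def by metis
  obtain \<eta> where 2: "g = (Y, (arr_functor g, \<eta>), Z)"
    "\<eta> \<in> extensional (Obj (base (fst Y)))"
    "\<And>x. x \<in> Obj (base (fst Y)) \<Longrightarrow> \<eta> x = (OMap (snd Y) x, arr_map g x, OMap (snd Z) (OMap (arr_lift g) x))"
    using HomT_E[OF g] unfolding is_nat_trans_def by metis
  have L: "lift (fst X) (comp_functor (fst X) (arr_functor g) (arr_functor f)) =
    comp_functor (base (fst X)) (arr_lift g) (arr_lift f)"
    by (simp add: lift_comp[OF HomT_functor[OF f] HomT_functor[OF g]] HomT_lift_eq[OF f] HomT_lift_eq[OF g])
  have "Comp T g f = (X, (comp_functor (fst X) (arr_functor g) (arr_functor f),
     \<lambda>x\<in>Obj (base (fst X)). Comp Set_cat (\<eta> (OMap (arr_lift f) x)) (\<theta> x)), Z)"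
    by (subst 1(1), subst 2(1)) (cases X, cases Y, simp add: TDX_def tdx_comp_def HomT_lift_eq[OF f])
  also have "\<dots> = tdx_mk X (comp_functor (fst X) (arr_functor g) (arr_functor f))
    (\<lambda>x z. arr_map g (OMap (arr_lift f) x) (arr_map f x z)) Z"
    unfolding tdx_mk_def L
    using functor_OMap[OF HomT_lift[OF f]]
    by (auto simp: 1(3) 2(3) Set_cat_def compose_def OMap_comp_functor cong: restrict_cong)
  finally show ?thesis .
qed

lemma arr_functor_Comp: "f \<in> Hom T X Y \<Longrightarrow> g \<in> Hom T Y Z \<Longrightarrow>
    arr_functor (Comp T g f) = comp_functor (fst X) (arr_functor g) (arr_functor f)"
  and arr_map_Comp: "f \<in> Hom T X Y \<Longrightarrow> g \<in> Hom T Y Z \<Longrightarrow> x \<in> Obj (base (fst X)) \<Longrightarrow> z \<in> elts (OMap (snd X) x) \<Longrightarrow>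
    arr_map (Comp T g f) x z = arr_map g (OMap (arr_lift f) x) (arr_map f x z)"
  by (simp_all add: Comp_TDX_mk arr_functor_mk arr_map_mk)

lemma arr_lift_Comp:
  assumes "f \<in> Hom T X Y" "g \<in> Hom T Y Z"
  shows "arr_lift (Comp T g f) = comp_functor (base (fst X)) (arr_lift g) (arr_lift f)"
  using assms by (simp add: Comp_TDX_mk arr_lift_mk lift_comp[OF HomT_functor HomT_functor]
      HomT_lift_eq)

lemma Comp_TDX:
  assumes f: "f \<in> Hom T X Y" and g: "g \<in> Hom T Y Z"
  shows "Comp T g f \<in> Hom T X Z"
  unfolding Comp_TDX_mk[OF f g]
proof (rule tdx_mk_Hom)
  have c: "category (base (fst X))" using f by (simp add: HomT_Dom tdx_objD category_base)
  have L: "lift (fst X) (comp_functor (fst X) (arr_functor g) (arr_functor f)) =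
    comp_functor (base (fst X)) (arr_lift g) (arr_lift f)"
    by (simp add: lift_comp[OF HomT_functor[OF f] HomT_functor[OF g]] HomT_lift_eq[OF f] HomT_lift_eq[OF g])
  note lf = HomT_lift[OF f]
  show "arr_map g (OMap (arr_lift f) x) (arr_map f x z)
    \<in> elts (OMap (snd Z) (OMap (lift (fst X) (comp_functor (fst X) (arr_functor g) (arr_functor f))) x))"
    if "x \<in> Obj (base (fst X))" "z \<in> elts (OMap (snd X) x)" for x z
    using HomT_map[OF f that] HomT_map[OF g functor_OMap[OF lf]] that by (simp add: L OMap_comp_functor)
  show "arr_map g (OMap (arr_lift f) (Cod (base (fst X)) u)) (arr_map f (Cod (base (fst X)) u) (act (snd X) u z)) =
    act (snd Z) (AMap (lift (fst X) (comp_functor (fst X) (arr_functor g) (arr_functor f))) u)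
     (arr_map g (OMap (arr_lift f) (Dom (base (fst X)) u)) (arr_map f (Dom (base (fst X)) u) z))"
    if u: "u \<in> Arr (base (fst X))" "z \<in> elts (OMap (snd X) (Dom (base (fst X)) u))" for u z
    using HomT_natural[OF f u] HomT_map[OF f category_Dom[OF c u(1)] u(2)]
      HomT_natural[OF g functor_AMap[OF lf u(1)], of "arr_map f (Dom (base (fst X)) u) z"] u(1)
    by (simp add: L AMap_comp_functor functor_Dom[OF lf u(1)] functor_Cod[OF lf u(1)])
qed (use assms in \<open>auto intro: HomT_Dom HomT_Cod is_functor_comp HomT_functor\<close>)

lemma Ident_TDX_mk:
  "X \<in> Obj T \<Longrightarrow> Ident T X = tdx_mk X (id_functor (fst X)) (\<lambda>x z. z) X"
  by (cases X) (auto simp: TDX_def tdx_ident_def tdx_mk_def Set_cat_def lift_id OMap_id_functor id_def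
      cong: restrict_cong)

lemma Ident_TDX: "X \<in> Obj T \<Longrightarrow> Ident T X \<in> Hom T X X"
  unfolding Ident_TDX_mk
  by (rule tdx_mk_Hom) (auto simp: lift_id comp_functor_simps is_functor_id tdx_objD category_base category_simps)

lemma arr_Ident:
  assumes "X \<in> Obj T"
  shows "arr_functor (Ident T X) = id_functor (fst X)" "arr_lift (Ident T X) = id_functor (base (fst X))"
    "x \<in> Obj (base (fst X)) \<Longrightarrow> z \<in> elts (OMap (snd X) x) \<Longrightarrow> arr_map (Ident T X) x z = z"
  using assms by (simp_all add: Ident_TDX_mk arr_functor_mk arr_lift_mk arr_map_mk lift_id)

lemma Arr_TDX: "f \<in> Arr T \<longleftrightarrow> f \<in> Hom T (Dom T f) (Cod T f)"
  by (simp add: Hom_def)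

lemma TDX_assoc:
  assumes f: "f \<in> Hom T X Y" and g: "g \<in> Hom T Y Z" and h: "h \<in> Hom T Z W"
  shows "Comp T h (Comp T g f) = Comp T (Comp T h g) f"
proof (rule HomT_eqI[of _ X W])
  show "arr_functor (Comp T h (Comp T g f)) = arr_functor (Comp T (Comp T h g) f)"
    using arr_functor_Comp[OF Comp_TDX[OF f g] h] arr_functor_Comp[OF f Comp_TDX[OF g h]]
      arr_functor_Comp[OF f g] arr_functor_Comp[OF g h]
      comp_functor_assoc[OF HomT_functor[OF f] HomT_functor[OF g] HomT_functor[OF h]] by simp
  show "arr_map (Comp T h (Comp T g f)) x z = arr_map (Comp T (Comp T h g) f) x z"
    if xz: "x \<in> Obj (base (fst X))" "z \<in> elts (OMap (snd X) x)" for x z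
    using arr_map_Comp[OF Comp_TDX[OF f g] h xz] arr_map_Comp[OF f Comp_TDX[OF g h] xz]
      arr_map_Comp[OF f g xz] arr_map_Comp[OF g h functor_OMap[OF HomT_lift[OF f] xz(1)] HomT_map[OF f xz]]
      arr_lift_Comp[OF f g] xz(1) by (simp add: OMap_comp_functor)
qed (use assms in \<open>auto intro: Comp_TDX\<close>)

lemma TDX_Ident_right:
  assumes f: "f \<in> Hom T X Y" shows "Comp T f (Ident T X) = f"
proof (rule HomT_eqI[of _ X Y])
  note X = HomT_Dom[OF f]
  show "Comp T f (Ident T X) \<in> Hom T X Y" by (rule Comp_TDX[OF Ident_TDX[OF X] f])
  show "arr_functor (Comp T f (Ident T X)) = arr_functor f"
    using arr_functor_Comp[OF Ident_TDX[OF X] f] comp_functor_id[OF HomT_functor[OF f]] by (simp add: arr_Ident X)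
  show "arr_map (Comp T f (Ident T X)) x z = arr_map f x z"
    if "x \<in> Obj (base (fst X))" "z \<in> elts (OMap (snd X) x)" for x z
    using arr_map_Comp[OF Ident_TDX[OF X] f that] that by (simp add: arr_Ident X OMap_id_functor)
qed (rule f)

lemma TDX_Ident_left:
  assumes f: "f \<in> Hom T X Y" shows "Comp T (Ident T Y) f = f"
proof (rule HomT_eqI[of _ X Y])
  note Y = HomT_Cod[OF f]
  show "Comp T (Ident T Y) f \<in> Hom T X Y" by (rule Comp_TDX[OF f Ident_TDX[OF Y]])
  show "arr_functor (Comp T (Ident T Y) f) = arr_functor f"
    using arr_functor_Comp[OF f Ident_TDX[OF Y]] id_comp_functor[OF HomT_functor[OF f]] by (simp add: arr_Ident Y)
  show "arr_map (Comp T (Ident T Y) f) x z = arr_map f x z"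
    if "x \<in> Obj (base (fst X))" "z \<in> elts (OMap (snd X) x)" for x z
    using arr_map_Comp[OF f Ident_TDX[OF Y] that] functor_OMap[OF HomT_lift[OF f] that(1)] HomT_map[OF f that]
    by (simp add: arr_Ident Y)
qed (rule f)

lemma category_TDX: "category T"
proof -
  have "Dom T f \<in> Obj T" "Cod T f \<in> Obj T" if "f \<in> Arr T" for f
    using that unfolding Arr_TDX by (auto intro: HomT_Dom HomT_Cod)
  moreover have "Comp T g f \<in> Hom T (Dom T f) (Cod T g)" if "f \<in> Arr T" "g \<in> Arr T" "Dom T g = Cod T f" for f g
    using that unfolding Arr_TDX by (metis Comp_TDX)
  moreover have "Comp T f (Ident T (Dom T f)) = f" "Comp T (Ident T (Cod T f)) f = f" if "f \<in> Arr T" for f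
    using that unfolding Arr_TDX by (auto intro: TDX_Ident_right TDX_Ident_left)
  moreover have "Comp T h (Comp T g f) = Comp T (Comp T h g) f"
    if "f \<in> Arr T" "g \<in> Arr T" "h \<in> Arr T" "Dom T g = Cod T f" "Dom T h = Cod T g" for f g h
    using that unfolding Arr_TDX by (metis TDX_assoc)
  ultimately show ?thesis unfolding category_def by (simp add: Ident_TDX)
qed

end

section \<open>Encoding small subobjects of products over arbitrary index sets, and joint
  injectivity\<close>

section \<open>Small subobjects of large products\<close>

lemma jointly_injectiveD:
  assumes "inj_on (\<lambda>x. \<lambda>k\<in>K. f k x) S" "x \<in> S" "y \<in> S" "\<And>k. k \<in> K \<Longrightarrow> f k x = f k y"
  shows "x = y"
  using assms by (auto dest!: inj_onD[of _ S x y] simp: restrict_def fun_eq_iff)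

lemma family_eqI:
  assumes "N \<subseteq> Pi\<^sub>E K X" "a \<in> N" "b \<in> N" "\<And>k. k \<in> K \<Longrightarrow> a k = b k"
  shows "a = b"
  using assms by (intro PiE_ext[of a K X b]) auto

lemma family_restrict: "N \<subseteq> Pi\<^sub>E K X \<Longrightarrow> a \<in> N \<Longrightarrow> (\<lambda>k\<in>K. a k) = a"
  by (auto intro: PiE_restrict)

text \<open>Operations are performed componentwise on families and then re-encoded. A family is
  determined by its components, so each category axiom for \<open>S\<close> follows from the same
  axiom in all \<open>Q k\<close>. Smallness is asked of \<open>Ob\<close> and \<open>M\<close>,
  which leaves \<open>K\<close> free to be a proper class.\<close>

lemma subproduct_category:
  fixes Q :: "'k \<Rightarrow> 'v::zfc_universe cat"
  assumes Q: "\<And>k. k \<in> K \<Longrightarrow> category (Q k)"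
    and Ob: "Ob \<subseteq> (\<Pi>\<^sub>E k\<in>K. Obj (Q k))" "esmall TYPE('v) Ob"
    and M: "M \<subseteq> (\<Pi>\<^sub>E k\<in>K. Arr (Q k))" "esmall TYPE('v) M"
    and dom: "\<And>m. m \<in> M \<Longrightarrow> (\<lambda>k\<in>K. Dom (Q k) (m k)) \<in> Ob"
    and cod: "\<And>m. m \<in> M \<Longrightarrow> (\<lambda>k\<in>K. Cod (Q k) (m k)) \<in> Ob"
    and ident: "\<And>x. x \<in> Ob \<Longrightarrow> (\<lambda>k\<in>K. Ident (Q k) (x k)) \<in> M"
    and comp: "\<And>m n. m \<in> M \<Longrightarrow> n \<in> M \<Longrightarrow> (\<And>k. k \<in> K \<Longrightarrow> Dom (Q k) (n k) = Cod (Q k) (m k)) \<Longrightarrow>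
      (\<lambda>k\<in>K. Comp (Q k) (n k) (m k)) \<in> M"
  obtains S :: "'v cat" and F where "S \<in> Obj Cat" "\<And>k. k \<in> K \<Longrightarrow> is_functor S (Q k) (F k)"
    "bij_betw (\<lambda>x. \<lambda>k\<in>K. OMap (F k) x) (Obj S) Ob" "bij_betw (\<lambda>x. \<lambda>k\<in>K. AMap (F k) x) (Arr S) M"
proof -
  obtain ob :: 'v and d where d: "bij_betw d (elts ob) Ob" using Ob(2) by (rule esmall_encode)
  obtain ar :: 'v and e where e: "bij_betw e (elts ar) M" using M(2) by (rule esmall_encode)
  have dO: "d x \<in> Ob" if "x \<in> elts ob" for x using d that by (auto simp: bij_betw_def)
  have eM: "e x \<in> M" if "x \<in> elts ar" for x using e that by (auto simp: bij_betw_def)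
  have "\<exists>x. x \<in> elts ob \<and> d x = w" if "w \<in> Ob" for w using d that by (auto simp: bij_betw_def)
  \<comment> \<open>\<open>c\<close>, and likewise \<open>b\<close> below, chooses codes of
    families: right inverses of the decodings \<open>d\<close> and \<open>e\<close>.\<close>
  then obtain c where c: "\<And>w. w \<in> Ob \<Longrightarrow> c w \<in> elts ob" "\<And>w. w \<in> Ob \<Longrightarrow> d (c w) = w" by metis
  have "\<exists>x. x \<in> elts ar \<and> e x = w" if "w \<in> M" for w using e that by (auto simp: bij_betw_def)
  then obtain b where b: "\<And>w. w \<in> M \<Longrightarrow> b w \<in> elts ar" "\<And>w. w \<in> M \<Longrightarrow> e (b w) = w" by metis
  define DM where "DM x = c (\<lambda>k\<in>K. Dom (Q k) (e x k))" for x
  define CM where "CM x = c (\<lambda>k\<in>K. Cod (Q k) (e x k))" for x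
  define IM where "IM x = b (\<lambda>k\<in>K. Ident (Q k) (d x k))" for x
  define PM where "PM y x = b (\<lambda>k\<in>K. Comp (Q k) (e y k) (e x k))" for y x
  have dob: "d x k \<in> Obj (Q k)" if "x \<in> elts ob" "k \<in> K" for x k using dO[OF that(1)] Ob(1) that(2) by auto
  have ear: "e x k \<in> Arr (Q k)" if "x \<in> elts ar" "k \<in> K" for x k using eM[OF that(1)] M(1) that(2) by auto
  have DM: "DM x \<in> elts ob" "\<And>k. k \<in> K \<Longrightarrow> d (DM x) k = Dom (Q k) (e x k)" if "x \<in> elts ar" for x
    using c[OF dom[OF eM[OF that]]] by (simp_all add: DM_def)
  have CM: "CM x \<in> elts ob" "\<And>k. k \<in> K \<Longrightarrow> d (CM x) k = Cod (Q k) (e x k)" if "x \<in> elts ar" for x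
    using c[OF cod[OF eM[OF that]]] by (simp_all add: CM_def)
  have IM: "IM x \<in> elts ar" "\<And>k. k \<in> K \<Longrightarrow> e (IM x) k = Ident (Q k) (d x k)" if "x \<in> elts ob" for x
    using b[OF ident[OF dO[OF that]]] by (simp_all add: IM_def)
  have dc: "Dom (Q k) (e y k) = Cod (Q k) (e x k)"
    if "x \<in> elts ar" "y \<in> elts ar" "DM y = CM x" "k \<in> K" for x y k
    using that DM(2) CM(2) by metis
  have PM: "PM y x \<in> elts ar" "\<And>k. k \<in> K \<Longrightarrow> e (PM y x) k = Comp (Q k) (e y k) (e x k)"
    if "x \<in> elts ar" "y \<in> elts ar" "DM y = CM x" for x y
    using b[OF comp[OF eM eM dc], OF that(1,2) that] by (simp_all add: PM_def)
  have deq: "x = y" if "x \<in> elts ob" "y \<in> elts ob" "\<And>k. k \<in> K \<Longrightarrow> d x k = d y k" for x y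
  proof -
    have "d x = d y" by (rule family_eqI[OF Ob(1) dO[OF that(1)] dO[OF that(2)] that(3)])
    then show ?thesis using d that by (auto simp: bij_betw_def dest: inj_onD)
  qed
  have eeq: "x = y" if "x \<in> elts ar" "y \<in> elts ar" "\<And>k. k \<in> K \<Longrightarrow> e x k = e y k" for x y
  proof -
    have "e x = e y" by (rule family_eqI[OF M(1) eM[OF that(1)] eM[OF that(2)] that(3)])
    then show ?thesis using e that by (auto simp: bij_betw_def dest: inj_onD)
  qed
  \<comment> \<open>The restrictions, and the value \<open>undefined\<close> off composable pairs,
    make \<open>S\<close> normalized, as membership in \<open>Obj Cat\<close> demands.\<close>
  define S where "S = \<lparr>Obj = elts ob, Arr = elts ar, Dom = restrict DM (elts ar), Cod = restrict CM (elts ar),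
    Ident = restrict IM (elts ob),
    Comp = (\<lambda>g f. if f \<in> elts ar \<and> g \<in> elts ar \<and> DM g = CM f then PM g f else undefined)\<rparr>"
  define F where "F k = \<lparr>OMap = (\<lambda>x\<in>elts ob. d x k), AMap = (\<lambda>x\<in>elts ar. e x k)\<rparr>" for k
  have dPM: "DM (PM y x) = DM x" "CM (PM y x) = CM y"
    if "x \<in> elts ar" "y \<in> elts ar" "DM y = CM x" for x y
  proof -
    note k = category_Dom_Comp[OF Q ear[OF that(1)] ear[OF that(2)] dc[OF that]]
      category_Cod_Comp[OF Q ear[OF that(1)] ear[OF that(2)] dc[OF that]]
    show "DM (PM y x) = DM x"
      by (rule deq) (simp_all add: DM that PM k)
    show "CM (PM y x) = CM y"
      by (rule deq) (simp_all add: CM that PM k)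
  qed
  have dIM: "DM (IM x) = x" "CM (IM x) = x" if "x \<in> elts ob" for x
  proof -
    show "DM (IM x) = x" by (rule deq) (simp_all add: DM IM that category_Dom_Ident[OF Q dob])
    show "CM (IM x) = x" by (rule deq) (simp_all add: CM IM that category_Cod_Ident[OF Q dob])
  qed
  have cat: "category S"
    unfolding category_def
  proof (intro conjI ballI impI)
    fix f assume "f \<in> Arr S"
    then have f: "f \<in> elts ar" by (simp add: S_def)
    show "Dom S f \<in> Obj S" "Cod S f \<in> Obj S" using f by (simp_all add: S_def DM CM)
    have "PM f (IM (DM f)) = f"
      by (rule eeq) (simp_all add: f PM IM DM CM dIM category_Comp_Ident[OF Q ear])
    moreover have "PM (IM (CM f)) f = f"
      by (rule eeq) (simp_all add: f PM IM DM CM dIM category_Ident_Comp[OF Q ear])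
    ultimately show "Comp S f (Ident S (Dom S f)) = f" "Comp S (Ident S (Cod S f)) f = f"
      using f by (simp_all add: S_def DM CM IM dIM)
    fix g assume "g \<in> Arr S" "Dom S g = Cod S f"
    then have g: "g \<in> elts ar" "DM g = CM f" using f by (simp_all add: S_def)
    show "Comp S g f \<in> Hom S (Dom S f) (Cod S g)"
      using f g by (simp add: S_def Hom_def PM dPM)
    fix h assume "h \<in> Arr S" "Dom S h = Cod S g"
    then have h: "h \<in> elts ar" "DM h = CM g" using g by (simp_all add: S_def)
    have "PM h (PM g f) = PM (PM h g) f"
      by (rule eeq) (simp_all add: f g h PM dPM category_assoc[OF Q ear[OF f] ear[OF g(1)] ear[OF h(1)]
          dc[OF f g] dc[OF g(1) h]])
    then show "Comp S h (Comp S g f) = Comp S (Comp S h g) f"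
      using f g h by (simp add: S_def PM dPM)
  next
    fix x assume "x \<in> Obj S"
    then show "Ident S x \<in> Hom S x x" by (simp add: S_def Hom_def IM dIM)
  qed
  have "normalized S" by (auto simp: normalized_def S_def)
  moreover have "small_category S" using cat by (simp add: small_category_def S_def small_def)
  ultimately have SC: "S \<in> Obj Cat" by (simp add: Cat_def)
  have F: "is_functor S (Q k) (F k)" if "k \<in> K" for k
    by (rule is_functorI[OF cat Q[OF that]])
      (use that in \<open>auto simp: S_def F_def dob ear DM CM IM PM\<close>)
  have "bij_betw (\<lambda>x. \<lambda>k\<in>K. OMap (F k) x) (Obj S) Ob = bij_betw d (elts ob) Ob"
    unfolding S_def F_def category.simps functor_maps.simps
  proof (rule bij_betw_cong)
    fix x assume "x \<in> elts ob"
    then show "(\<lambda>k\<in>K. (\<lambda>x\<in>elts ob. d x k) x) = d x"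
      using family_restrict[OF Ob(1) dO] by simp
  qed
  moreover have "bij_betw (\<lambda>x. \<lambda>k\<in>K. AMap (F k) x) (Arr S) M = bij_betw e (elts ar) M"
    unfolding S_def F_def category.simps functor_maps.simps
  proof (rule bij_betw_cong)
    fix x assume "x \<in> elts ar"
    then show "(\<lambda>k\<in>K. (\<lambda>x\<in>elts ar. e x k) x) = e x"
      using family_restrict[OF M(1) eM] by simp
  qed
  ultimately show ?thesis using d e by (intro that[of S F] SC F) simp_all
qed

context transducers
begin

text \<open>The same re-encoding for tables, over a category \<open>Q\<close> that is already
  available. Each \<open>G x\<close> is encoded separately, and an arrow of the base acts on a
  family through all the lifted functors at once, so the functor laws are inherited from the
  components.\<close>

lemma subproduct_transducer:
  fixes X :: "'k \<Rightarrow> 'v tdx"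
  assumes X: "\<And>k. k \<in> K \<Longrightarrow> X k \<in> Obj T" and Q: "Q \<in> Obj Cat"
    and F: "\<And>k. k \<in> K \<Longrightarrow> is_functor Q (fst (X k)) (F k)"
    and G: "\<And>x. x \<in> Obj (base Q) \<Longrightarrow> G x \<subseteq> (\<Pi>\<^sub>E k\<in>K. elts (OMap (snd (X k)) (OMap (lift Q (F k)) x)))"
      "\<And>x. x \<in> Obj (base Q) \<Longrightarrow> esmall TYPE('v) (G x)"
    and G_act: "\<And>u z. u \<in> Arr (base Q) \<Longrightarrow> z \<in> G (Dom (base Q) u) \<Longrightarrow>
      (\<lambda>k\<in>K. act (snd (X k)) (AMap (lift Q (F k)) u) (z k)) \<in> G (Cod (base Q) u)"
  obtains S p where "S \<in> Obj T" "fst S = Q" "\<And>k. k \<in> K \<Longrightarrow> p k \<in> Hom T S (X k)"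
    "\<And>k. k \<in> K \<Longrightarrow> arr_functor (p k) = F k"
    "\<And>x. x \<in> Obj (base Q) \<Longrightarrow> bij_betw (\<lambda>z. \<lambda>k\<in>K. arr_map (p k) x z) (elts (OMap (snd S) x)) (G x)"
proof -
  have c: "category (base Q)" using Q by (auto intro: category_base simp: Cat_def small_category_def)
  have "\<exists>(r::'v) d. bij_betw d (elts r) (G x)" if "x \<in> Obj (base Q)" for x
    using esmall_encode[OF G(2)[OF that]] by metis
  then obtain R :: "_ \<Rightarrow> 'v" and d where d: "\<And>x. x \<in> Obj (base Q) \<Longrightarrow> bij_betw (d x) (elts (R x)) (G x)" by metis
  have dG: "d x z \<in> G x" if "x \<in> Obj (base Q)" "z \<in> elts (R x)" for x z
    using d[OF that(1)] that(2) by (auto simp: bij_betw_def)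
  have dR: "d x z k \<in> elts (OMap (snd (X k)) (OMap (lift Q (F k)) x))"
    if "x \<in> Obj (base Q)" "z \<in> elts (R x)" "k \<in> K" for x z k
    using dG[OF that(1,2)] G(1)[OF that(1)] that(3) by auto
  have deq: "z = w" if "x \<in> Obj (base Q)" "z \<in> elts (R x)" "w \<in> elts (R x)" "\<And>k. k \<in> K \<Longrightarrow> d x z k = d x w k" for x z w
  proof -
    have "d x z = d x w" by (rule family_eqI[OF G(1)[OF that(1)] dG[OF that(1,2)] dG[OF that(1,3)] that(4)])
    then show ?thesis using d[OF that(1)] that by (auto simp: bij_betw_def dest: inj_onD)
  qed
  have ex: "\<exists>z'. z' \<in> elts (R (Cod (base Q) u)) \<and>
      d (Cod (base Q) u) z' = (\<lambda>k\<in>K. act (snd (X k)) (AMap (lift Q (F k)) u) (d (Dom (base Q) u) z k))"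
    if "u \<in> Arr (base Q)" "z \<in> elts (R (Dom (base Q) u))" for u z
    using G_act[OF that(1) dG[OF category_Dom[OF c that(1)] that(2)]]
    unfolding bij_betw_imp_surj_on[OF d[OF category_Cod[OF c that(1)]], symmetric] by auto
  \<comment> \<open>A code of the componentwise image: \<open>G_act\<close> guarantees that one
    exists, and \<open>deq\<close> makes any two of them equal.\<close>
  define a where "a u z = (SOME z'. z' \<in> elts (R (Cod (base Q) u)) \<and>
      d (Cod (base Q) u) z' = (\<lambda>k\<in>K. act (snd (X k)) (AMap (lift Q (F k)) u) (d (Dom (base Q) u) z k)))" for u z
  have a: "a u z \<in> elts (R (Cod (base Q) u))"
    and da: "d (Cod (base Q) u) (a u z) = (\<lambda>k\<in>K. act (snd (X k)) (AMap (lift Q (F k)) u) (d (Dom (base Q) u) z k))"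
    if "u \<in> Arr (base Q)" "z \<in> elts (R (Dom (base Q) u))" for u z
    using someI_ex[OF ex[OF that]] unfolding a_def by (rule conjunct1, rule conjunct2)
  let ?t = "set_functor (base Q) R a"
  define S where "S = (Q, ?t)"
  note L = is_functor_lift[OF F]
  have t: "is_functor (base Q) Set_cat ?t"
  proof (rule is_functor_set_functor[OF c])
    show "a (Ident (base Q) x) z = z" if x: "x \<in> Obj (base Q)" "z \<in> elts (R x)" for x z
    proof (rule deq[OF x(1) _ x(2)])
      note i = category_Ident[OF c x(1)] category_Dom_Ident[OF c x(1)] category_Cod_Ident[OF c x(1)]
      show "a (Ident (base Q) x) z \<in> elts (R x)" using a[OF i(1)] x i by simp
      show "d x (a (Ident (base Q) x) z) k = d x z k" if "k \<in> K" for k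
        using da[OF i(1)] x i(2,3) that dR[OF x that]
        by (simp add: functor_Ident[OF L[OF that]] functor_OMap[OF L[OF that]] act_Ident[OF tdx_objD(5)[OF X[OF that]]])
    qed
    show "a (Comp (base Q) w u) z = a w (a u z)"
      if uw: "u \<in> Arr (base Q)" "w \<in> Arr (base Q)" "Dom (base Q) w = Cod (base Q) u"
        and z: "z \<in> elts (R (Dom (base Q) u))" for u w z
    proof (rule deq[OF category_Cod[OF c uw(2)]])
      note i = category_Comp[OF c uw] category_Dom_Comp[OF c uw] category_Cod_Comp[OF c uw]
      note az = a[OF uw(1) z]
      show "a (Comp (base Q) w u) z \<in> elts (R (Cod (base Q) w))" using a[OF i(1)] z i by simp
      show "a w (a u z) \<in> elts (R (Cod (base Q) w))" using a[OF uw(2)] az uw by simp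
      show "d (Cod (base Q) w) (a (Comp (base Q) w u) z) k = d (Cod (base Q) w) (a w (a u z)) k" if k: "k \<in> K" for k
      proof -
        note Lk = L[OF k]
        have zk: "d (Dom (base Q) u) z k \<in> elts (OMap (snd (X k)) (Dom (base (fst (X k))) (AMap (lift Q (F k)) u)))"
          using dR[OF category_Dom[OF c uw(1)] z k] by (simp add: functor_Dom[OF Lk uw(1)])
        have "d (Cod (base Q) w) (a (Comp (base Q) w u) z) k =
            act (snd (X k)) (AMap (lift Q (F k)) (Comp (base Q) w u)) (d (Dom (base Q) u) z k)"
          using da[OF i(1)] z i k by simp
        also have "\<dots> = act (snd (X k)) (AMap (lift Q (F k)) w)
            (act (snd (X k)) (AMap (lift Q (F k)) u) (d (Dom (base Q) u) z k))"
          unfolding functor_Comp[OF Lk uw]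
          by (rule act_Comp[OF tdx_objD(5)[OF X[OF k]]])
            (use uw zk in \<open>auto simp: functor_AMap[OF Lk] functor_Dom[OF Lk] functor_Cod[OF Lk]\<close>)
        also have "\<dots> = d (Cod (base Q) w) (a w (a u z)) k"
          using da[OF uw(2), of "a u z"] da[OF uw(1) z] az uw(3) k by simp
        finally show ?thesis .
      qed
    qed
  qed (rule a)
  have S: "S \<in> Obj T" unfolding S_def by (rule tdx_objI[OF Q t])
  define p where "p k = tdx_mk S (F k) (\<lambda>x z. d x z k) (X k)" for k
  have p: "p k \<in> Hom T S (X k)" if k: "k \<in> K" for k
    unfolding p_def
  proof (rule tdx_mk_Hom[OF S X[OF k]])
    show "is_functor (fst S) (fst (X k)) (F k)" using F[OF k] by (simp add: S_def)
    show "d x z k \<in> elts (OMap (snd (X k)) (OMap (lift (fst S) (F k)) x))"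
      if "x \<in> Obj (base (fst S))" "z \<in> elts (OMap (snd S) x)" for x z
      using that dR[OF _ _ k] by (simp add: S_def OMap_set_functor)
    show "d (Cod (base (fst S)) u) (act (snd S) u z) k =
          act (snd (X k)) (AMap (lift (fst S) (F k)) u) (d (Dom (base (fst S)) u) z k)"
      if "u \<in> Arr (base (fst S))" "z \<in> elts (OMap (snd S) (Dom (base (fst S)) u))" for u z
      using that da[of u z] k by (simp add: S_def OMap_set_functor category_Dom[OF c] act_set_functor)
  qed
  have "bij_betw (\<lambda>z. \<lambda>k\<in>K. arr_map (p k) x z) (elts (OMap (snd S) x)) (G x)" if x: "x \<in> Obj (base Q)" for x
  proof -
    have R: "OMap (snd S) x = R x" using x by (simp add: S_def OMap_set_functor)
    have "bij_betw (\<lambda>z. \<lambda>k\<in>K. arr_map (p k) x z) (elts (R x)) (G x) = bij_betw (d x) (elts (R x)) (G x)"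
    proof (rule bij_betw_cong)
      fix z assume z: "z \<in> elts (R x)"
      have "arr_map (p k) x z = d x z k" for k
        unfolding p_def by (rule arr_map_mk) (use x z R in \<open>auto simp: S_def\<close>)
      then show "(\<lambda>k\<in>K. arr_map (p k) x z) = d x z"
        using family_restrict[OF G(1)[OF x] dG[OF x z]] by simp
    qed
    then show ?thesis using d[OF x] R by simp
  qed
  moreover have "arr_functor (p k) = F k" for k by (simp add: p_def arr_functor_mk)
  ultimately show ?thesis by (intro that[of S p] S p) (simp_all add: S_def)
qed

text \<open>An elementwise form of joint monicity, which can be read off from the bijections of the
  two encodings and used on single objects, arrows and entries. Entries are compared only at a
  common index of \<open>S\<close>.\<close>

definition jointly_injective :: "'k set \<Rightarrow> ('k \<Rightarrow> 'v tdx) \<Rightarrow> 'v tdx \<Rightarrow> ('k \<Rightarrow> 'v tdx_arrow) \<Rightarrow> bool" where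
  "jointly_injective K X S p \<longleftrightarrow> (\<forall>k\<in>K. p k \<in> Hom T S (X k)) \<and>
     inj_on (\<lambda>x. \<lambda>k\<in>K. OMap (arr_functor (p k)) x) (Obj (fst S)) \<and>
     inj_on (\<lambda>m. \<lambda>k\<in>K. AMap (arr_functor (p k)) m) (Arr (fst S)) \<and>
     (\<forall>x\<in>Obj (base (fst S)). inj_on (\<lambda>z. \<lambda>k\<in>K. arr_map (p k) x z) (elts (OMap (snd S) x)))"

lemma jointly_injectiveT_D:
  assumes "jointly_injective K X S p"
  shows ji_Hom: "k \<in> K \<Longrightarrow> p k \<in> Hom T S (X k)"
    and ji_Obj: "x \<in> Obj (fst S) \<Longrightarrow> y \<in> Obj (fst S) \<Longrightarrow>
      (\<And>k. k \<in> K \<Longrightarrow> OMap (arr_functor (p k)) x = OMap (arr_functor (p k)) y) \<Longrightarrow> x = y"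
    and ji_Arr: "m \<in> Arr (fst S) \<Longrightarrow> n \<in> Arr (fst S) \<Longrightarrow>
      (\<And>k. k \<in> K \<Longrightarrow> AMap (arr_functor (p k)) m = AMap (arr_functor (p k)) n) \<Longrightarrow> m = n"
    and ji_elts: "w \<in> Obj (base (fst S)) \<Longrightarrow> z \<in> elts (OMap (snd S) w) \<Longrightarrow> z' \<in> elts (OMap (snd S) w) \<Longrightarrow>
      (\<And>k. k \<in> K \<Longrightarrow> arr_map (p k) w z = arr_map (p k) w z') \<Longrightarrow> z = z'"
     apply (use assms in \<open>auto simp: jointly_injective_def\<close>)[1]
    apply (rule jointly_injectiveD[of "\<lambda>k. OMap (arr_functor (p k))" K "Obj (fst S)"]; use assms in \<open>auto simp: jointly_injective_def\<close>)
   apply (rule jointly_injectiveD[of "\<lambda>k. AMap (arr_functor (p k))" K "Arr (fst S)"]; use assms in \<open>auto simp: jointly_injective_def\<close>)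
  apply (rule jointly_injectiveD[of "\<lambda>k. arr_map (p k) w" K "elts (OMap (snd S) w)"]; use assms in \<open>auto simp: jointly_injective_def\<close>)
  done

text \<open>The functors are shown equal first. This makes the two image indices equal, and only
  then do both image entries lie in one table of \<open>S\<close>, where injectivity
  applies.\<close>

lemma jointly_injective_imp_monic:
  assumes ji: "jointly_injective K X S p" and f: "f \<in> Hom T Y S" and g: "g \<in> Hom T Y S"
    and eq: "\<And>k. k \<in> K \<Longrightarrow> Comp T (p k) f = Comp T (p k) g"
  shows "f = g"
proof -
  note p = ji_Hom[OF ji]
  have F: "comp_functor (fst Y) (arr_functor (p k)) (arr_functor f) =
     comp_functor (fst Y) (arr_functor (p k)) (arr_functor g)" if "k \<in> K" for k
    using arr_functor_Comp[OF f p[OF that]] arr_functor_Comp[OF g p[OF that]] eq[OF that] by simp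
  have fg: "arr_functor f = arr_functor g"
  proof (rule functor_eqI[OF HomT_functor[OF f] HomT_functor[OF g]])
    show "OMap (arr_functor f) x = OMap (arr_functor g) x" if x: "x \<in> Obj (fst Y)" for x
      by (rule ji_Obj[OF ji]) (use x F[THEN arg_cong, of _ "\<lambda>F. OMap F x"] in
          \<open>auto simp: functor_OMap[OF HomT_functor[OF f]] functor_OMap[OF HomT_functor[OF g]] OMap_comp_functor\<close>)
    show "AMap (arr_functor f) x = AMap (arr_functor g) x" if x: "x \<in> Arr (fst Y)" for x
      by (rule ji_Arr[OF ji]) (use x F[THEN arg_cong, of _ "\<lambda>F. AMap F x"] in
          \<open>auto simp: functor_AMap[OF HomT_functor[OF f]] functor_AMap[OF HomT_functor[OF g]] AMap_comp_functor\<close>)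
  qed
  then have L: "arr_lift f = arr_lift g" by (simp add: HomT_lift_eq[OF f] HomT_lift_eq[OF g])
  show ?thesis
  proof (rule HomT_eqI[OF f g fg])
    fix x z assume xz: "x \<in> Obj (base (fst Y))" "z \<in> elts (OMap (snd Y) x)"
    show "arr_map f x z = arr_map g x z"
    proof (rule ji_elts[OF ji functor_OMap[OF HomT_lift[OF f] xz(1)] HomT_map[OF f xz]])
      show "arr_map g x z \<in> elts (OMap (snd S) (OMap (arr_lift f) x))"
        using HomT_map[OF g xz] L by simp
      show "arr_map (p k) (OMap (arr_lift f) x) (arr_map f x z) = arr_map (p k) (OMap (arr_lift f) x) (arr_map g x z)"
        if "k \<in> K" for k
        using arr_map_Comp[OF f p[OF that] xz] arr_map_Comp[OF g p[OF that] xz] eq[OF that] L by simp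
    qed
  qed
qed

text \<open>Preimages are chosen separately for objects, arrows and entries; joint injectivity then
  transfers functoriality and naturality from the \<open>h k\<close> to these choices. In
  \<open>el\<close> the index \<open>x\<close> is any one with the same projections as
  \<open>y\<close>, because the functor that supplies the right index is built only inside the
  proof.\<close>

lemma jointly_injective_factor:
  assumes ji: "jointly_injective K X S p" and S: "S \<in> Obj T" and Y: "Y \<in> Obj T"
    and h: "\<And>k. k \<in> K \<Longrightarrow> h k \<in> Hom T Y (X k)"
    and ob: "\<And>y. y \<in> Obj (fst Y) \<Longrightarrow>
      (\<lambda>k\<in>K. OMap (arr_functor (h k)) y) \<in> (\<lambda>x. \<lambda>k\<in>K. OMap (arr_functor (p k)) x) ` Obj (fst S)"
    and ar: "\<And>y. y \<in> Arr (fst Y) \<Longrightarrow>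
      (\<lambda>k\<in>K. AMap (arr_functor (h k)) y) \<in> (\<lambda>x. \<lambda>k\<in>K. AMap (arr_functor (p k)) x) ` Arr (fst S)"
    and el: "\<And>y x z. y \<in> Obj (base (fst Y)) \<Longrightarrow> x \<in> Obj (base (fst S)) \<Longrightarrow>
      (\<And>k. k \<in> K \<Longrightarrow> OMap (arr_lift (p k)) x = OMap (arr_lift (h k)) y) \<Longrightarrow> z \<in> elts (OMap (snd Y) y) \<Longrightarrow>
      (\<lambda>k\<in>K. arr_map (h k) y z) \<in> (\<lambda>z. \<lambda>k\<in>K. arr_map (p k) x z) ` elts (OMap (snd S) x)"
  obtains g where "g \<in> Hom T Y S" "\<And>k. k \<in> K \<Longrightarrow> Comp T (p k) g = h k"
proof -
  note p = ji_Hom[OF ji]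
  note cY = tdx_objD(3)[OF Y] and cS = tdx_objD(3)[OF S]
  have "\<exists>x. x \<in> Obj (fst S) \<and> (\<forall>k\<in>K. OMap (arr_functor (p k)) x = OMap (arr_functor (h k)) y)"
    if "y \<in> Obj (fst Y)" for y
    using ob[OF that] by (auto simp: restrict_def fun_eq_iff) metis
  then obtain gO where gO: "\<And>y. y \<in> Obj (fst Y) \<Longrightarrow> gO y \<in> Obj (fst S)"
    "\<And>y k. y \<in> Obj (fst Y) \<Longrightarrow> k \<in> K \<Longrightarrow> OMap (arr_functor (p k)) (gO y) = OMap (arr_functor (h k)) y" by metis
  have "\<exists>x. x \<in> Arr (fst S) \<and> (\<forall>k\<in>K. AMap (arr_functor (p k)) x = AMap (arr_functor (h k)) y)"
    if "y \<in> Arr (fst Y)" for y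
    using ar[OF that] by (auto simp: restrict_def fun_eq_iff) metis
  then obtain gA where gA: "\<And>y. y \<in> Arr (fst Y) \<Longrightarrow> gA y \<in> Arr (fst S)"
    "\<And>y k. y \<in> Arr (fst Y) \<Longrightarrow> k \<in> K \<Longrightarrow> AMap (arr_functor (p k)) (gA y) = AMap (arr_functor (h k)) y" by metis
  define F where "F = \<lparr>OMap = restrict gO (Obj (fst Y)), AMap = restrict gA (Arr (fst Y))\<rparr>"
  have DG: "Dom (fst S) (gA f) = gO (Dom (fst Y) f)" "Cod (fst S) (gA f) = gO (Cod (fst Y) f)" if "f \<in> Arr (fst Y)" for f
  proof -
    note d = category_Dom[OF cY that] category_Cod[OF cY that]
    note d' = category_Dom[OF cS gA(1)[OF that]] category_Cod[OF cS gA(1)[OF that]]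
    have "OMap (arr_functor (p k)) (Dom (fst S) (gA f)) = OMap (arr_functor (p k)) (gO (Dom (fst Y) f))"
      "OMap (arr_functor (p k)) (Cod (fst S) (gA f)) = OMap (arr_functor (p k)) (gO (Cod (fst Y) f))"
      if k: "k \<in> K" for k
      using functor_Dom[OF HomT_functor[OF p[OF k]] gA(1)[OF \<open>f \<in> Arr (fst Y)\<close>]]
        functor_Cod[OF HomT_functor[OF p[OF k]] gA(1)[OF \<open>f \<in> Arr (fst Y)\<close>]]
        functor_Dom[OF HomT_functor[OF h[OF k]] \<open>f \<in> Arr (fst Y)\<close>]
        functor_Cod[OF HomT_functor[OF h[OF k]] \<open>f \<in> Arr (fst Y)\<close>]
      by (simp_all add: gO(2)[OF d(1) k] gO(2)[OF d(2) k] gA(2)[OF \<open>f \<in> Arr (fst Y)\<close> k])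
    then show "Dom (fst S) (gA f) = gO (Dom (fst Y) f)" "Cod (fst S) (gA f) = gO (Cod (fst Y) f)"
      using ji_Obj[OF ji d'(1) gO(1)[OF d(1)]] ji_Obj[OF ji d'(2) gO(1)[OF d(2)]] by blast+
  qed
  have F: "is_functor (fst Y) (fst S) F"
  proof (rule is_functorI[OF cY cS])
    show "AMap F (Ident (fst Y) x) = Ident (fst S) (OMap F x)" if x: "x \<in> Obj (fst Y)" for x
    proof -
      note i = category_Ident[OF cY x]
      have "gA (Ident (fst Y) x) = Ident (fst S) (gO x)"
      proof (rule ji_Arr[OF ji gA(1)[OF i] category_Ident[OF cS gO(1)[OF x]]])
        show "AMap (arr_functor (p k)) (gA (Ident (fst Y) x)) = AMap (arr_functor (p k)) (Ident (fst S) (gO x))"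
          if k: "k \<in> K" for k
          by (simp add: gA(2)[OF i k] gO(2)[OF x k] functor_Ident[OF HomT_functor[OF p[OF k]] gO(1)[OF x]]
              functor_Ident[OF HomT_functor[OF h[OF k]] x])
      qed
      then show ?thesis using x i by (simp add: F_def)
    qed
    show "AMap F (Comp (fst Y) g f) = Comp (fst S) (AMap F g) (AMap F f)"
      if fg: "f \<in> Arr (fst Y)" "g \<in> Arr (fst Y)" "Dom (fst Y) g = Cod (fst Y) f" for f g
    proof -
      note c = category_Comp[OF cY fg]
      have d: "Dom (fst S) (gA g) = Cod (fst S) (gA f)" using fg by (simp add: DG)
      have "gA (Comp (fst Y) g f) = Comp (fst S) (gA g) (gA f)"
      proof (rule ji_Arr[OF ji gA(1)[OF c] category_Comp[OF cS gA(1)[OF fg(1)] gA(1)[OF fg(2)] d]])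
        show "AMap (arr_functor (p k)) (gA (Comp (fst Y) g f)) = AMap (arr_functor (p k)) (Comp (fst S) (gA g) (gA f))"
          if k: "k \<in> K" for k
          by (simp add: gA(2)[OF c k] gA(2)[OF fg(1) k] gA(2)[OF fg(2) k] functor_Comp[OF HomT_functor[OF h[OF k]] fg]
              functor_Comp[OF HomT_functor[OF p[OF k]] gA(1)[OF fg(1)] gA(1)[OF fg(2)] d])
      qed
      then show ?thesis using fg c by (simp add: F_def)
    qed
  qed (auto simp: F_def gO gA DG category_simps[OF cY])
  have pF: "comp_functor (fst Y) (arr_functor (p k)) F = arr_functor (h k)" if k: "k \<in> K" for k
    by (rule functor_eqI[OF is_functor_comp[OF F HomT_functor[OF p[OF k]]] HomT_functor[OF h[OF k]]])
      (use k in \<open>auto simp: comp_functor_simps F_def gO gA\<close>)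
  note L = is_functor_lift[OF F]
  have pL: "comp_functor (base (fst Y)) (arr_lift (p k)) (lift (fst Y) F) = arr_lift (h k)" if k: "k \<in> K" for k
    using lift_comp[OF F HomT_functor[OF p[OF k]]] by (simp add: pF k HomT_lift_eq[OF p[OF k]] HomT_lift_eq[OF h[OF k]])
  have pLO: "OMap (arr_lift (p k)) (OMap (lift (fst Y) F) y) = OMap (arr_lift (h k)) y"
    if "k \<in> K" "y \<in> Obj (base (fst Y))" for k y
    using pL[OF that(1)] OMap_comp_functor[OF that(2)] by metis
  have pLA: "AMap (arr_lift (p k)) (AMap (lift (fst Y) F) u) = AMap (arr_lift (h k)) u"
    if "k \<in> K" "u \<in> Arr (base (fst Y))" for k u
    using pL[OF that(1)] AMap_comp_functor[OF that(2)] by metis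
  have "\<exists>x. x \<in> elts (OMap (snd S) (OMap (lift (fst Y) F) y)) \<and>
      (\<forall>k\<in>K. arr_map (p k) (OMap (lift (fst Y) F) y) x = arr_map (h k) y z)"
    if yz: "y \<in> Obj (base (fst Y))" "z \<in> elts (OMap (snd Y) y)" for y z
    using el[OF yz(1) functor_OMap[OF L yz(1)] pLO[OF _ yz(1)] yz(2)]
    by (auto simp: restrict_def fun_eq_iff) metis
  then obtain m where m: "\<And>y z. y \<in> Obj (base (fst Y)) \<Longrightarrow> z \<in> elts (OMap (snd Y) y) \<Longrightarrow>
      m y z \<in> elts (OMap (snd S) (OMap (lift (fst Y) F) y))"
    and pm: "\<And>y z k. y \<in> Obj (base (fst Y)) \<Longrightarrow> z \<in> elts (OMap (snd Y) y) \<Longrightarrow> k \<in> K \<Longrightarrow>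
      arr_map (p k) (OMap (lift (fst Y) F) y) (m y z) = arr_map (h k) y z" by metis
  let ?g = "tdx_mk Y F m S"
  have bY: "category (base (fst Y))" by (rule category_base[OF cY])
  have g: "?g \<in> Hom T Y S"
  proof (rule tdx_mk_Hom[OF Y S F m])
    fix u z assume u: "u \<in> Arr (base (fst Y))" and z: "z \<in> elts (OMap (snd Y) (Dom (base (fst Y)) u))"
    let ?D = "Dom (base (fst Y)) u" and ?C = "Cod (base (fst Y)) u" and ?u = "AMap (lift (fst Y) F) u"
    note D = category_Dom[OF bY u] and C = category_Cod[OF bY u]
    note az = act_closed[OF tdx_objD(5)[OF Y] u z]
    note Lu = functor_AMap[OF L u] functor_Dom[OF L u] functor_Cod[OF L u]
    show "m ?C (act (snd Y) u z) = act (snd S) ?u (m ?D z)"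
    proof (rule ji_elts[OF ji functor_OMap[OF L C] m[OF C az]])
      show "act (snd S) ?u (m ?D z) \<in> elts (OMap (snd S) (OMap (lift (fst Y) F) ?C))"
        using act_closed[OF tdx_objD(5)[OF S] Lu(1)] m[OF D z] by (simp add: Lu)
      show "arr_map (p k) (OMap (lift (fst Y) F) ?C) (m ?C (act (snd Y) u z)) =
        arr_map (p k) (OMap (lift (fst Y) F) ?C) (act (snd S) ?u (m ?D z))" if k: "k \<in> K" for k
        using HomT_natural[OF h[OF k] u z] HomT_natural[OF p[OF k] Lu(1), of "m ?D z"] m[OF D z]
          pm[OF C az k] pm[OF D z k] pLA[OF k u] by (simp add: Lu)
    qed
  qed
  have "Comp T (p k) ?g = h k" if k: "k \<in> K" for k
  proof (rule HomT_eqI[OF Comp_TDX[OF g p[OF k]] h[OF k]])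
    show "arr_functor (Comp T (p k) ?g) = arr_functor (h k)"
      using arr_functor_Comp[OF g p[OF k]] by (simp add: arr_functor_mk pF k)
    show "arr_map (Comp T (p k) ?g) x z = arr_map (h k) x z"
      if "x \<in> Obj (base (fst Y))" "z \<in> elts (OMap (snd Y) x)" for x z
      using arr_map_Comp[OF g p[OF k] that] that by (simp add: arr_map_mk arr_lift_mk pm k)
  qed
  then show ?thesis using that g by blast
qed

section \<open>The forgetful functor and its cartesian lifts\<close>

section \<open>The fibration\<close>

lemma tdx_forget_simps:
  "X \<in> Obj T \<Longrightarrow> OMap (tdx_forget A B) X = fst X"
  "f \<in> Hom T X Y \<Longrightarrow> AMap (tdx_forget A B) f = (fst X, arr_functor f, fst Y)"
  by (auto simp: tdx_forget_def TDX_def Hom_def arr_functor_def tdx_arr_def)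

lemma Hom_Cat_iff: "F \<in> Hom Cat P Q \<longleftrightarrow> (\<exists>G. F = (P, G, Q) \<and> P \<in> Obj Cat \<and> Q \<in> Obj Cat \<and> is_functor P Q G)"
  by (auto simp: Hom_def Cat_def)

lemma Comp_Cat: "Comp Cat (Q, G, R) (P, F, Q') = (P, comp_functor P G F, R)"
  by (simp add: Cat_def)

lemma is_functor_forget: "is_functor T (Cat :: ('v cat, 'v cat_arrow) category) (tdx_forget A B)"
proof (rule is_functorI[OF category_TDX category_Cat])
  show "OMap (tdx_forget A B) \<in> extensional (Obj T)" "AMap (tdx_forget A B) \<in> extensional (Arr T)"
    by (auto simp: tdx_forget_def TDX_def)
  show "OMap (tdx_forget A B) X \<in> Obj Cat" if "X \<in> Obj T" for X
    using that by (simp add: tdx_forget_simps tdx_objD)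
  have U: "AMap (tdx_forget A B) f \<in> Hom Cat (OMap (tdx_forget A B) (Dom T f)) (OMap (tdx_forget A B) (Cod T f))"
    if f: "f \<in> Arr T" for f
    using f[unfolded Arr_TDX]
    by (auto simp: tdx_forget_simps HomT_Dom HomT_Cod Hom_Cat_iff HomT_functor tdx_objD)
  then show "AMap (tdx_forget A B) f \<in> Arr Cat"
    "Dom Cat (AMap (tdx_forget A B) f) = OMap (tdx_forget A B) (Dom T f)"
    "Cod Cat (AMap (tdx_forget A B) f) = OMap (tdx_forget A B) (Cod T f)" if "f \<in> Arr T" for f
    using that by (auto simp: Hom_def)
  show "AMap (tdx_forget A B) (Ident T X) = Ident Cat (OMap (tdx_forget A B) X)" if "X \<in> Obj T" for X
    using tdx_forget_simps(2)[OF Ident_TDX[OF that]] that by (simp add: tdx_forget_simps arr_Ident Cat_def)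
  show "AMap (tdx_forget A B) (Comp T g f) = Comp Cat (AMap (tdx_forget A B) g) (AMap (tdx_forget A B) f)"
    if fg: "f \<in> Arr T" "g \<in> Arr T" "Dom T g = Cod T f" for f g
  proof -
    have f: "f \<in> Hom T (Dom T f) (Cod T f)" and g: "g \<in> Hom T (Cod T f) (Cod T g)"
      using fg by (auto simp: Hom_def)
    show ?thesis
      using tdx_forget_simps(2)[OF f] tdx_forget_simps(2)[OF g] tdx_forget_simps(2)[OF Comp_TDX[OF f g]]
      by (simp add: Comp_Cat arr_functor_Comp[OF f g])
  qed
qed

text \<open>The table of \<open>X\<close> at \<open>x\<close> is the table of \<open>Y\<close> at
  the lifted index. So a map of entries into \<open>X\<close> over \<open>G\<close> is literally a
  map of entries into \<open>Y\<close> over the composite of \<open>F\<close> with \<open>G\<close>,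
  which gives both existence and uniqueness of factorizations.\<close>

lemma cartesian_reindexing:
  assumes Y: "Y \<in> Obj T" and P: "P \<in> Obj Cat" and F: "is_functor P (fst Y) F"
  defines "X \<equiv> (P, comp_functor (base P) (snd Y) (lift P F))"
  defines "\<phi> \<equiv> tdx_mk X F (\<lambda>x z. z) Y"
  shows "cartesian T Cat (tdx_forget A B) \<phi>" "\<phi> \<in> Hom T X Y" "AMap (tdx_forget A B) \<phi> = (P, F, fst Y)"
proof -
  note L = is_functor_lift[OF F]
  have t: "is_functor (base P) Set_cat (comp_functor (base P) (snd Y) (lift P F))"
    by (rule is_functor_comp[OF L tdx_objD(5)[OF Y]])
  have X: "X \<in> Obj T" unfolding X_def by (rule tdx_objI[OF P t])
  have fX: "fst X = P" by (simp add: X_def)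
  show \<phi>: "\<phi> \<in> Hom T X Y"
    unfolding \<phi>_def by (rule tdx_mk_Hom[OF X Y])
      (auto simp: X_def F OMap_comp_functor act_comp_functor)
  then show U: "AMap (tdx_forget A B) \<phi> = (P, F, fst Y)"
    by (simp add: tdx_forget_simps(2)[OF \<phi>] fX) (simp add: \<phi>_def arr_functor_mk)
  have a\<phi>: "arr_functor \<phi> = F" by (simp add: \<phi>_def arr_functor_mk)
  have m\<phi>: "arr_map \<phi> x z = z" if "x \<in> Obj (base P)" "z \<in> elts (OMap (snd X) x)" for x z
    using that unfolding \<phi>_def by (intro arr_map_mk) (auto simp: X_def)
  show "cartesian T Cat (tdx_forget A B) \<phi>"
    unfolding cartesian_def
  proof (intro conjI ballI impI)
    show "\<phi> \<in> Arr T" using \<phi> by (simp add: Hom_def)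
    fix \<psi> g assume psi: "\<psi> \<in> Arr T" "Cod T \<psi> = Cod T \<phi>"
      and g: "g \<in> Hom Cat (OMap (tdx_forget A B) (Dom T \<psi>)) (OMap (tdx_forget A B) (Dom T \<phi>))"
      and eq: "Comp Cat (AMap (tdx_forget A B) \<phi>) g = AMap (tdx_forget A B) \<psi>"
    define W where "W = Dom T \<psi>"
    have DC: "Dom T \<phi> = X" "Cod T \<phi> = Y" using \<phi> by (auto simp: Hom_def)
    have \<psi>: "\<psi> \<in> Hom T W Y" using psi DC by (simp add: Hom_def W_def)
    note W = HomT_Dom[OF \<psi>]
    obtain G where G: "g = (fst W, G, P)" "is_functor (fst W) P G"
      using g DC W X fX by (auto simp: Hom_Cat_iff tdx_forget_simps W_def)
    have FG: "comp_functor (fst W) F G = arr_functor \<psi>"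
      using eq by (simp add: U tdx_forget_simps(2)[OF \<psi>] G Comp_Cat)
    have LFG: "comp_functor (base (fst W)) (lift P F) (lift (fst W) G) = arr_lift \<psi>"
      by (simp add: HomT_lift_eq[OF \<psi>] lift_comp[OF G(2) F] flip: FG)
    have LO: "OMap (lift P F) (OMap (lift (fst W) G) x) = OMap (arr_lift \<psi>) x" if "x \<in> Obj (base (fst W))" for x
      using LFG OMap_comp_functor[OF that] by metis
    have LA: "AMap (lift P F) (AMap (lift (fst W) G) x) = AMap (arr_lift \<psi>) x" if "x \<in> Arr (base (fst W))" for x
      using LFG AMap_comp_functor[OF that] by metis
    note LG = functor_OMap[OF is_functor_lift[OF G(2)]] functor_AMap[OF is_functor_lift[OF G(2)]]
    \<comment> \<open>The entry maps of \<open>\<psi>\<close>, read as maps into the reindexed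
      tables; \<open>LO\<close> and \<open>LA\<close> match the indices.\<close>
    define \<chi> where "\<chi> = tdx_mk W G (arr_map \<psi>) X"
    have \<chi>: "\<chi> \<in> Hom T W X"
      unfolding \<chi>_def
      by (rule tdx_mk_Hom[OF W X])
        (auto simp: fX G X_def OMap_comp_functor LG LO LA act_comp_functor HomT_map[OF \<psi>] HomT_natural[OF \<psi>])
    have a\<chi>: "arr_functor \<chi> = G" by (simp add: \<chi>_def arr_functor_mk)
    \<comment> \<open>Composing with \<open>\<phi>\<close> does not change the values on entries, so
      every competing factorization has the entry maps of \<open>\<psi>\<close>.\<close>
    have mC: "arr_map (Comp T \<phi> \<gamma>) x z = arr_map \<gamma> x z"
      if "\<gamma> \<in> Hom T W X" "arr_functor \<gamma> = G" "x \<in> Obj (base (fst W))" "z \<in> elts (OMap (snd W) x)" for \<gamma> x z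
      using arr_map_Comp[OF that(1) \<phi> that(3,4)] m\<phi>[OF functor_OMap[OF HomT_lift[OF that(1)] that(3), unfolded fX]
          HomT_map[OF that(1,3,4)]] by simp
    have 1: "Comp T \<phi> \<chi> = \<psi>"
    proof (rule HomT_eqI[OF Comp_TDX[OF \<chi> \<phi>] \<psi>])
      show "arr_functor (Comp T \<phi> \<chi>) = arr_functor \<psi>"
        by (simp add: arr_functor_Comp[OF \<chi> \<phi>] a\<phi> a\<chi> FG)
      show "arr_map (Comp T \<phi> \<chi>) x z = arr_map \<psi> x z" if "x \<in> Obj (base (fst W))" "z \<in> elts (OMap (snd W) x)" for x z
        using mC[OF \<chi> a\<chi> that] that by (simp add: \<chi>_def arr_map_mk)
    qed
    have 2: "\<gamma> = \<chi>" if \<gamma>: "\<gamma> \<in> Hom T W X" "AMap (tdx_forget A B) \<gamma> = g" "Comp T \<phi> \<gamma> = \<psi>" for \<gamma>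
    proof (rule HomT_eqI[OF \<gamma>(1) \<chi>])
      have "arr_functor \<gamma> = G" using \<gamma>(2) by (simp add: tdx_forget_simps(2)[OF \<gamma>(1)] G)
      then show "arr_functor \<gamma> = arr_functor \<chi>" "\<And>x z. x \<in> Obj (base (fst W)) \<Longrightarrow> z \<in> elts (OMap (snd W) x) \<Longrightarrow>
          arr_map \<gamma> x z = arr_map \<chi> x z"
        using mC[OF \<gamma>(1)] mC[OF \<chi> a\<chi>] \<gamma>(3) 1 a\<chi> by auto
    qed
    have "AMap (tdx_forget A B) \<chi> = g" by (simp add: tdx_forget_simps(2)[OF \<chi>] a\<chi> G fX)
    then show "\<exists>!\<chi>. \<chi> \<in> Hom T (Dom T \<psi>) (Dom T \<phi>) \<and> AMap (tdx_forget A B) \<chi> = g \<and> Comp T \<phi> \<chi> = \<psi>"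
      using \<chi> 1 2 unfolding W_def[symmetric] DC by blast
  qed
qed

lemma fibration_forget: "fibration T Cat (tdx_forget A B)"
  unfolding fibration_def
proof (intro conjI ballI impI is_functor_forget)
  fix Y f assume Y: "Y \<in> Obj T" and f: "f \<in> Arr Cat" "Cod Cat f = OMap (tdx_forget A B) Y"
  then obtain P F where "f = (P, F, fst Y)" "P \<in> Obj Cat" "is_functor P (fst Y) F"
    by (auto simp: Cat_def tdx_forget_simps)
  then show "\<exists>\<phi>. cartesian T Cat (tdx_forget A B) \<phi> \<and> Cod T \<phi> = Y \<and> AMap (tdx_forget A B) \<phi> = f"
    using cartesian_reindexing[OF Y, of P F] HomD by metis
qed

lemma jointly_injectiveI:
  assumes "S \<in> Obj T" "\<And>k. k \<in> K \<Longrightarrow> p k \<in> Hom T S (X k)"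
    "bij_betw (\<lambda>x. \<lambda>k\<in>K. OMap (arr_functor (p k)) x) (Obj (fst S)) N"
    "bij_betw (\<lambda>m. \<lambda>k\<in>K. AMap (arr_functor (p k)) m) (Arr (fst S)) M"
    "\<And>x. x \<in> Obj (base (fst S)) \<Longrightarrow> bij_betw (\<lambda>z. \<lambda>k\<in>K. arr_map (p k) x z) (elts (OMap (snd S) x)) (G x)"
  shows "jointly_injective K X S p"
  using assms unfolding jointly_injective_def bij_betw_def by blast

section \<open>Limits as 2-transducers of compatible families\<close>

section \<open>Limits\<close>

text \<open>The values of a cone on an object, arrow or entry of its vertex form a compatible
  family, which is what \<open>jointly_injective_factor\<close> asks for. Smallness comes from
  \<open>esmall_PiE\<close>, the objects of \<open>J\<close> being small. For empty \<open>J\<close>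
  each set of families is a singleton, and the result is the terminal 2-transducer.\<close>

lemma TDX_has_limit:
  fixes J :: "'v cat"
  assumes J: "small_category J" and D: "is_functor J T D"
  shows "\<exists>S p. is_limit J T D S p"
proof -
  define K where "K = Obj J"
  define X where "X = OMap D"
  define d where "d = AMap D"
  have cJ: "category J" using J by (simp add: small_category_def)
  have K: "esmall TYPE('v) K" using J by (simp add: K_def small_category_def small_esmall)
  have X: "X j \<in> Obj T" if "j \<in> K" for j using that functor_OMap[OF D] by (simp add: X_def K_def)
  have dK: "Dom J u \<in> K" "Cod J u \<in> K" if "u \<in> Arr J" for u
    using category_Dom[OF cJ that] category_Cod[OF cJ that] by (simp_all add: K_def)
  have d: "d u \<in> Hom T (X (Dom J u)) (X (Cod J u))" if "u \<in> Arr J" for u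
    using functor_simps[OF D] that by (simp add: d_def X_def Hom_def)
  note dF = HomT_functor[OF d]
  have smX: "esmall TYPE('v) (Obj (fst (X j)))" "esmall TYPE('v) (Arr (fst (X j)))" if "j \<in> K" for j
    using tdx_objD(2)[OF X[OF that]] by (auto simp: small_category_def small_esmall)
  define N where "N = {x \<in> \<Pi>\<^sub>E j\<in>K. Obj (fst (X j)). \<forall>u\<in>Arr J. OMap (arr_functor (d u)) (x (Dom J u)) = x (Cod J u)}"
  define M where "M = {x \<in> \<Pi>\<^sub>E j\<in>K. Arr (fst (X j)). \<forall>u\<in>Arr J. AMap (arr_functor (d u)) (x (Dom J u)) = x (Cod J u)}"
  have N: "N \<subseteq> (\<Pi>\<^sub>E j\<in>K. Obj (fst (X j)))" "esmall TYPE('v) N"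
    by (auto simp: N_def intro: esmall_subset[OF esmall_PiE[OF K smX(1)]])
  have M: "M \<subseteq> (\<Pi>\<^sub>E j\<in>K. Arr (fst (X j)))" "esmall TYPE('v) M"
    by (auto simp: M_def intro: esmall_subset[OF esmall_PiE[OF K smX(2)]])
  have Mj: "m j \<in> Arr (fst (X j))" if "m \<in> M" "j \<in> K" for m j using that by (auto simp: M_def)
  have Nj: "x j \<in> Obj (fst (X j))" if "x \<in> N" "j \<in> K" for x j using that by (auto simp: N_def)
  have Mu: "m (Cod J u) = AMap (arr_functor (d u)) (m (Dom J u))" if "m \<in> M" "u \<in> Arr J" for m u
    using that by (auto simp: M_def)
  have Nu: "x (Cod J u) = OMap (arr_functor (d u)) (x (Dom J u))" if "x \<in> N" "u \<in> Arr J" for x u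
    using that by (auto simp: N_def)
  note cX = tdx_objD(3)[OF X]
  obtain Q :: "'v cat" and F where Q: "Q \<in> Obj Cat" and F: "\<And>j. j \<in> K \<Longrightarrow> is_functor Q (fst (X j)) (F j)"
    and FN: "bij_betw (\<lambda>x. \<lambda>j\<in>K. OMap (F j) x) (Obj Q) N" and FM: "bij_betw (\<lambda>x. \<lambda>j\<in>K. AMap (F j) x) (Arr Q) M"
  proof (rule subproduct_category[OF cX N M])
    fix m assume m: "m \<in> M"
    show "(\<lambda>j\<in>K. Dom (fst (X j)) (m j)) \<in> N" "(\<lambda>j\<in>K. Cod (fst (X j)) (m j)) \<in> N"
      unfolding N_def using m
      by (auto simp: category_Dom[OF cX] category_Cod[OF cX] Mj dK Mu functor_Dom[OF dF] functor_Cod[OF dF])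
    fix n assume n: "n \<in> M" and c: "\<And>k. k \<in> K \<Longrightarrow> Dom (fst (X k)) (n k) = Cod (fst (X k)) (m k)"
    show "(\<lambda>k\<in>K. Comp (fst (X k)) (n k) (m k)) \<in> M"
      using m n c by (subst M_def) (auto simp: category_Comp[OF cX] Mj dK Mu functor_Comp[OF dF])
  next
    fix x assume x: "x \<in> N"
    show "(\<lambda>k\<in>K. Ident (fst (X k)) (x k)) \<in> M"
      unfolding M_def using x by (auto simp: category_Ident[OF cX] Nj dK Nu functor_Ident[OF dF])
  next
    fix S :: "'v cat" and F
    assume SF: "S \<in> Obj Cat" "\<And>k. k \<in> K \<Longrightarrow> is_functor S (fst (X k)) (F k)"
      "bij_betw (\<lambda>x. \<lambda>k\<in>K. OMap (F k) x) (Obj S) N" "bij_betw (\<lambda>x. \<lambda>k\<in>K. AMap (F k) x) (Arr S) M"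
    show thesis by (rule that[of S F]) (simp_all add: SF)
  qed
  have cQ: "category Q" using Q by (simp add: Cat_def small_category_def)
  have cbQ: "category (base Q)" by (rule category_base[OF cQ])
  \<comment> \<open>The projections of \<open>Q\<close> form a cone of functors, hence so do their
    lifts. This has to precede the tables: it ensures that \<open>d u\<close> sends an entry at the
    index over \<open>Dom J u\<close> to the table at the index over \<open>Cod J u\<close>, so
    compatibility of entries compares elements of one table.\<close>
  have dFc: "comp_functor Q (arr_functor (d u)) (F (Dom J u)) = F (Cod J u)" if u: "u \<in> Arr J" for u
  proof (rule functor_eqI[OF is_functor_comp[OF F[OF dK(1)[OF u]] dF[OF u]] F[OF dK(2)[OF u]]])
    fix x assume x: "x \<in> Obj Q"
    then have "(\<lambda>j\<in>K. OMap (F j) x) \<in> N" using FN by (auto simp: bij_betw_def)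
    from Nu[OF this u] show "OMap (comp_functor Q (arr_functor (d u)) (F (Dom J u))) x = OMap (F (Cod J u)) x"
      using x dK[OF u] by (simp add: OMap_comp_functor)
  next
    fix x assume x: "x \<in> Arr Q"
    then have "(\<lambda>j\<in>K. AMap (F j) x) \<in> M" using FM by (auto simp: bij_betw_def)
    from Mu[OF this u] show "AMap (comp_functor Q (arr_functor (d u)) (F (Dom J u))) x = AMap (F (Cod J u)) x"
      using x dK[OF u] by (simp add: AMap_comp_functor)
  qed
  have dL: "comp_functor (base Q) (arr_lift (d u)) (lift Q (F (Dom J u))) = lift Q (F (Cod J u))" if u: "u \<in> Arr J" for u
    using lift_comp[OF F[OF dK(1)[OF u]] dF[OF u]] by (simp add: dFc[OF u] HomT_lift_eq[OF d[OF u]])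
  have dLO: "OMap (arr_lift (d u)) (OMap (lift Q (F (Dom J u))) x) = OMap (lift Q (F (Cod J u))) x"
    if "u \<in> Arr J" "x \<in> Obj (base Q)" for u x using dL[OF that(1)] OMap_comp_functor[OF that(2)] by metis
  have dLA: "AMap (arr_lift (d u)) (AMap (lift Q (F (Dom J u))) x) = AMap (lift Q (F (Cod J u))) x"
    if "u \<in> Arr J" "x \<in> Arr (base Q)" for u x using dL[OF that(1)] AMap_comp_functor[OF that(2)] by metis
  define G where "G x = {z \<in> \<Pi>\<^sub>E j\<in>K. elts (OMap (snd (X j)) (OMap (lift Q (F j)) x)).
    \<forall>u\<in>Arr J. arr_map (d u) (OMap (lift Q (F (Dom J u))) x) (z (Dom J u)) = z (Cod J u)}" for x
  have Gj: "z j \<in> elts (OMap (snd (X j)) (OMap (lift Q (F j)) x))" if "z \<in> G x" "j \<in> K" for x z j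
    using that by (auto simp: G_def)
  have Gu: "z (Cod J u) = arr_map (d u) (OMap (lift Q (F (Dom J u))) x) (z (Dom J u))" if "z \<in> G x" "u \<in> Arr J" for x z u
    using that by (auto simp: G_def)
  have GP: "G x \<subseteq> (\<Pi>\<^sub>E j\<in>K. elts (OMap (snd (X j)) (OMap (lift Q (F j)) x)))" for x by (auto simp: G_def)
  have G_act: "(\<lambda>j\<in>K. act (snd (X j)) (AMap (lift Q (F j)) w) (z j)) \<in> G (Cod (base Q) w)"
    if w: "w \<in> Arr (base Q)" and z: "z \<in> G (Dom (base Q) w)" for w z
  proof -
    have L: "AMap (lift Q (F j)) w \<in> Arr (base (fst (X j)))"
      "Dom (base (fst (X j))) (AMap (lift Q (F j)) w) = OMap (lift Q (F j)) (Dom (base Q) w)"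
      "Cod (base (fst (X j))) (AMap (lift Q (F j)) w) = OMap (lift Q (F j)) (Cod (base Q) w)" if "j \<in> K" for j
      using functor_simps[OF is_functor_lift[OF F[OF that]]] w by auto
    have "act (snd (X j)) (AMap (lift Q (F j)) w) (z j) \<in> elts (OMap (snd (X j)) (OMap (lift Q (F j)) (Cod (base Q) w)))"
      if "j \<in> K" for j
      using act_closed[OF tdx_objD(5)[OF X[OF that]] L(1)[OF that], of "z j"] Gj[OF z that] by (simp add: L that)
    moreover have "arr_map (d u) (OMap (lift Q (F (Dom J u))) (Cod (base Q) w))
        (act (snd (X (Dom J u))) (AMap (lift Q (F (Dom J u))) w) (z (Dom J u))) =
      act (snd (X (Cod J u))) (AMap (lift Q (F (Cod J u))) w) (z (Cod J u))" if u: "u \<in> Arr J" for u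
      using HomT_natural[OF d[OF u] L(1)[OF dK(1)[OF u]], of "z (Dom J u)"] Gj[OF z dK(1)[OF u]] Gu[OF z u]
      by (simp add: L dK[OF u] dLA[OF u w])
    ultimately show ?thesis unfolding G_def using dK by auto
  qed
  obtain S p where S: "S \<in> Obj T" "fst S = Q" and p: "\<And>k. k \<in> K \<Longrightarrow> p k \<in> Hom T S (X k)"
    and pF: "\<And>k. k \<in> K \<Longrightarrow> arr_functor (p k) = F k"
    and pG: "\<And>x. x \<in> Obj (base Q) \<Longrightarrow> bij_betw (\<lambda>z. \<lambda>k\<in>K. arr_map (p k) x z) (elts (OMap (snd S) x)) (G x)"
    by (rule subproduct_transducer[OF X Q F GP _ G_act])
      (auto intro!: esmall_subset[OF esmall_PiE[OF K esmall_elts] GP])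
  have pL: "arr_lift (p k) = lift Q (F k)" if "k \<in> K" for k
    using HomT_lift_eq[OF p[OF that]] by (simp add: S pF that)
  have pN: "bij_betw (\<lambda>x. \<lambda>k\<in>K. OMap (arr_functor (p k)) x) (Obj Q) N"
    and pM: "bij_betw (\<lambda>x. \<lambda>k\<in>K. AMap (arr_functor (p k)) x) (Arr Q) M"
    using FN FM by (simp_all add: pF cong: restrict_cong)
  have ji: "jointly_injective K X S p"
    by (rule jointly_injectiveI[OF S(1) p]) (use pN pM pG in \<open>simp_all add: S\<close>)
  have cone: "is_cone J T D S p"
    unfolding is_cone_def X_def[symmetric] d_def[symmetric] K_def[symmetric]
  proof (intro conjI ballI S(1) p)
    fix u assume u: "u \<in> Arr J"
    note pu = p[OF dK(1)[OF u]]
    show "Comp T (d u) (p (Dom J u)) = p (Cod J u)"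
    proof (rule HomT_eqI[OF Comp_TDX[OF pu d[OF u]] p[OF dK(2)[OF u]]])
      show "arr_functor (Comp T (d u) (p (Dom J u))) = arr_functor (p (Cod J u))"
        by (simp add: arr_functor_Comp[OF pu d[OF u]] pF dK[OF u] S dFc[OF u])
      fix x z assume xz: "x \<in> Obj (base (fst S))" "z \<in> elts (OMap (snd S) x)"
      have "(\<lambda>k\<in>K. arr_map (p k) x z) \<in> G x"
        using pG[of x] xz by (auto simp: S bij_betw_def)
      from Gu[OF this u] show "arr_map (Comp T (d u) (p (Dom J u))) x z = arr_map (p (Cod J u)) x z"
        by (simp add: arr_map_Comp[OF pu d[OF u] xz] pL dK[OF u])
    qed
  qed
  have "\<exists>!h. h \<in> Hom T Y S \<and> (\<forall>j\<in>Obj J. Comp T (p j) h = q j)" if c: "is_cone J T D Y q" for Y q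
  proof -
    have Y: "Y \<in> Obj T" and q: "\<And>j. j \<in> K \<Longrightarrow> q j \<in> Hom T Y (X j)"
      and dq: "\<And>u. u \<in> Arr J \<Longrightarrow> Comp T (d u) (q (Dom J u)) = q (Cod J u)"
      using c by (auto simp: is_cone_def X_def d_def K_def)
    note qF = HomT_functor[OF q]
    have dqF: "arr_functor (q (Cod J u)) = comp_functor (fst Y) (arr_functor (d u)) (arr_functor (q (Dom J u)))"
      if u: "u \<in> Arr J" for u
      using arr_functor_Comp[OF q[OF dK(1)[OF u]] d[OF u]] dq[OF u] by simp
    obtain g where g: "g \<in> Hom T Y S" "\<And>k. k \<in> K \<Longrightarrow> Comp T (p k) g = q k"
    proof (rule jointly_injective_factor[OF ji S(1) Y q])
      fix y assume y: "y \<in> Obj (fst Y)"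
      have "(\<lambda>k\<in>K. OMap (arr_functor (q k)) y) \<in> N"
        unfolding N_def using y by (auto simp: dK functor_OMap[OF qF] dqF OMap_comp_functor)
      then show "(\<lambda>k\<in>K. OMap (arr_functor (q k)) y) \<in> (\<lambda>x. \<lambda>k\<in>K. OMap (arr_functor (p k)) x) ` Obj (fst S)"
        using pN by (simp add: S bij_betw_def)
    next
      fix y assume y: "y \<in> Arr (fst Y)"
      have "(\<lambda>k\<in>K. AMap (arr_functor (q k)) y) \<in> M"
        unfolding M_def using y by (auto simp: dK functor_AMap[OF qF] dqF AMap_comp_functor)
      then show "(\<lambda>k\<in>K. AMap (arr_functor (q k)) y) \<in> (\<lambda>x. \<lambda>k\<in>K. AMap (arr_functor (p k)) x) ` Arr (fst S)"
        using pM by (simp add: S bij_betw_def)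
    next
      fix y x z assume y: "y \<in> Obj (base (fst Y))" and x: "x \<in> Obj (base (fst S))"
        and e: "\<And>k. k \<in> K \<Longrightarrow> OMap (arr_lift (p k)) x = OMap (arr_lift (q k)) y" and z: "z \<in> elts (OMap (snd Y) y)"
      have "arr_map (d u) (OMap (lift Q (F (Dom J u))) x) (arr_map (q (Dom J u)) y z) = arr_map (q (Cod J u)) y z"
        if u: "u \<in> Arr J" for u
        using arr_map_Comp[OF q[OF dK(1)[OF u]] d[OF u] y z] dq[OF u] e[OF dK(1)[OF u]]
        by (simp add: pL dK[OF u])
      then have "(\<lambda>k\<in>K. arr_map (q k) y z) \<in> G x"
        unfolding G_def using HomT_map[OF q y z] e by (auto simp: dK pL)
      then show "(\<lambda>k\<in>K. arr_map (q k) y z) \<in> (\<lambda>z. \<lambda>k\<in>K. arr_map (p k) x z) ` elts (OMap (snd S) x)"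
        using pG[of x] x by (simp add: S bij_betw_def)
    next
      fix g assume g: "g \<in> Hom T Y S" "\<And>k. k \<in> K \<Longrightarrow> Comp T (p k) g = q k"
      show thesis by (rule that[of g]) (simp_all add: g)
    qed
    moreover have "h = g" if "h \<in> Hom T Y S" "\<forall>j\<in>Obj J. Comp T (p j) h = q j" for h
      by (rule jointly_injective_imp_monic[OF ji that(1) g(1)]) (use that(2) g(2) K_def in simp)
    ultimately show ?thesis using K_def by blast
  qed
  then show ?thesis using cone unfolding is_limit_def by blast
qed

end

section \<open>Colimits as generated parts of a product over all cocones\<close>

section \<open>Colimits\<close>

text \<open>The relation \<open>c\<close> is the domain of definition of the partial operation
  \<open>f\<close>. For families of arrows it is composability at every cocone.\<close>

inductive_set closure_under :: "('a \<Rightarrow> 'a \<Rightarrow> bool) \<Rightarrow> ('a \<Rightarrow> 'a \<Rightarrow> 'a) \<Rightarrow> 'a set \<Rightarrow> 'a set"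
  for c :: "'a \<Rightarrow> 'a \<Rightarrow> bool" and f :: "'a \<Rightarrow> 'a \<Rightarrow> 'a" and X :: "'a set" where
  gen: "x \<in> X \<Longrightarrow> x \<in> closure_under c f X"
| op: "x \<in> closure_under c f X \<Longrightarrow> y \<in> closure_under c f X \<Longrightarrow> c x y \<Longrightarrow> f x y \<in> closure_under c f X"

text \<open>Countably many stages suffice because the operation is binary: two elements always lie
  in a common stage.\<close>

lemma esmall_closure_under:
  assumes X: "esmall TYPE('v::zfc_universe) X" shows "esmall TYPE('v) (closure_under c f X)"
proof -
  \<comment> \<open>The stages apply \<open>f\<close> regardless of \<open>c\<close>; this only
    enlarges the set that covers the closure.\<close>
  define \<Phi> where "\<Phi> S = S \<union> (\<lambda>(x, y). f x y) ` (S \<times> S)" for S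
  define S where "S n = (\<Phi> ^^ n) X" for n
  have "mono S" unfolding S_def
    by (rule mono_iff_le_Suc[THEN iffD2]) (auto simp: \<Phi>_def)
  show ?thesis
  proof (rule esmall_iterate)
    show "esmall TYPE('v) (S n)" for n
      by (induction n) (auto simp: S_def \<Phi>_def X intro!: esmall_Un esmall_image esmall_Times)
    show "closure_under c f X \<subseteq> (\<Union>n. S n)"
    proof
      fix x assume "x \<in> closure_under c f X"
      then show "x \<in> (\<Union>n. S n)"
      proof induction
        case (gen x)
        then have "x \<in> S 0" by (simp add: S_def)
        then show ?case by blast
      next
        case (op x y)
        then obtain m n where "x \<in> S m" "y \<in> S n" by blast
        then have "x \<in> S (max m n)" "y \<in> S (max m n)"
          using \<open>mono S\<close> by (auto dest: monoD[of S m "max m n"] monoD[of S n "max m n"])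
        then have "f x y \<in> S (Suc (max m n))" by (force simp: S_def \<Phi>_def)
        then show ?case by blast
      qed
    qed
  qed
qed

context transducers
begin

text \<open>A lifted functor keeps the coordinates in \<open>A\<close> and in lists over
  \<open>B\<close> and applies \<open>F k\<close> to the two states. The states are separated
  jointly, the other coordinates by any single \<open>k\<close>; an empty family would leave them
  undetermined, hence \<open>K \<noteq> {}\<close>.\<close>

lemma lift_jointly_injective:
  assumes "x \<in> Obj (base Q)" "y \<in> Obj (base Q)" "K \<noteq> {}"
    and inj: "\<And>q r. q \<in> Obj Q \<Longrightarrow> r \<in> Obj Q \<Longrightarrow> (\<And>k. k \<in> K \<Longrightarrow> OMap (F k) q = OMap (F k) r) \<Longrightarrow> q = r"
    and eq: "\<And>k. k \<in> K \<Longrightarrow> OMap (lift Q (F k)) x = OMap (lift Q (F k)) y"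
  shows "x = y"
proof -
  obtain a q r b where x: "x = (a, q, r, b)" by (cases x)
  obtain a' q' r' b' where y: "y = (a', q', r', b')" by (cases y)
  have mem: "a \<in> Obj A" "q \<in> Obj Q" "r \<in> Obj Q" "b \<in> Obj (free_monoidal B)"
    "a' \<in> Obj A" "q' \<in> Obj Q" "r' \<in> Obj Q" "b' \<in> Obj (free_monoidal B)"
    using assms(1,2) by (auto simp: x y tdx_base_def prod_cat_def op_cat_def)
  have e: "a = a' \<and> OMap (F k) q = OMap (F k) q' \<and> OMap (F k) r = OMap (F k) r' \<and> b = b'" if "k \<in> K" for k
    using eq[OF that] mem
    by (simp add: x y tdx_base_functor_def Let_def prod_functor_def prod_cat_def op_cat_def id_functor_def)
  have "q = q'" "r = r'" using e mem by (auto intro: inj)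
  then show ?thesis using e assms(3) x y by blast
qed

text \<open>Existence of mediating morphisms is built into the index set, as every cocone
  contributes a projection. What takes work is that the generated part is small, that the legs
  factor through it, and that morphisms out of it are determined by their composites with the
  legs.\<close>

lemma TDX_has_colimit:
  fixes J :: "'v cat"
  assumes J: "small_category J" and D: "is_functor J T D"
  shows "\<exists>S i. is_colimit J T D S i"
proof -
  define I where "I = Obj J"
  define X where "X = OMap D"
  define d where "d = AMap D"
  \<comment> \<open>For \<open>k \<in> K\<close>, \<open>fst k\<close> is the vertex,
    \<open>fst (fst k)\<close> its category and \<open>snd k j\<close> the leg at
    \<open>j\<close>.\<close>
  define K where "K = {(Y, q). is_cocone J T D Y q}"
  have cJ: "category J" using J by (simp add: small_category_def)
  have I: "esmall TYPE('v) I" using J by (simp add: I_def small_category_def small_esmall)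
  have X: "X j \<in> Obj T" if "j \<in> I" for j using that functor_OMap[OF D] by (simp add: X_def I_def)
  have dI: "Dom J u \<in> I" "Cod J u \<in> I" if "u \<in> Arr J" for u
    using category_Dom[OF cJ that] category_Cod[OF cJ that] by (simp_all add: I_def)
  have d: "d u \<in> Hom T (X (Dom J u)) (X (Cod J u))" if "u \<in> Arr J" for u
    using functor_simps[OF D] that by (simp add: d_def X_def Hom_def)
  have smX: "esmall TYPE('v) (Obj (fst (X j)))" "esmall TYPE('v) (Arr (fst (X j)))" if "j \<in> I" for j
    using tdx_objD(2)[OF X[OF that]] by (auto simp: small_category_def small_esmall)
  note cX = tdx_objD(3)[OF X]
  have KT: "fst k \<in> Obj T" and leg: "\<And>j. j \<in> I \<Longrightarrow> snd k j \<in> Hom T (X j) (fst k)"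
    and legd: "\<And>u. u \<in> Arr J \<Longrightarrow> Comp T (snd k (Cod J u)) (d u) = snd k (Dom J u)" if "k \<in> K" for k
    using that by (auto simp: K_def is_cocone_def X_def d_def I_def)
  note cK = tdx_objD(3)[OF KT]
  note lF = HomT_functor[OF leg]
  \<comment> \<open>Diagram objects have equal families precisely when every cocone identifies them,
    so passing to families performs the quotient. Identified ends create new composable pairs, which
    is why the arrow families are closed under composition in \<open>M\<close>.\<close>
  define N where "N = (\<Union>j\<in>I. (\<lambda>x. \<lambda>k\<in>K. OMap (arr_functor (snd k j)) x) ` Obj (fst (X j)))"
  define M0 where "M0 = (\<Union>j\<in>I. (\<lambda>m. \<lambda>k\<in>K. AMap (arr_functor (snd k j)) m) ` Arr (fst (X j)))"
  define M where "M = closure_under (\<lambda>n m. \<forall>k\<in>K. Dom (fst (fst k)) (n k) = Cod (fst (fst k)) (m k))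
    (\<lambda>n m. \<lambda>k\<in>K. Comp (fst (fst k)) (n k) (m k)) M0"
  have N_I: "(\<lambda>k\<in>K. OMap (arr_functor (snd k j)) x) \<in> N" if "j \<in> I" "x \<in> Obj (fst (X j))" for j x
    unfolding N_def using that by blast
  have M0_I: "(\<lambda>k\<in>K. AMap (arr_functor (snd k j)) x) \<in> M0" if "j \<in> I" "x \<in> Arr (fst (X j))" for j x
    unfolding M0_def using that by blast
  have N_sub: "N \<subseteq> (\<Pi>\<^sub>E k\<in>K. Obj (fst (fst k)))"
    unfolding N_def by (intro UN_least image_subsetI restrict_PiE_iff[THEN iffD2] ballI functor_OMap[OF lF])
  have N_small: "esmall TYPE('v) N" unfolding N_def by (intro esmall_UN esmall_image smX I)
  have M0_sub: "M0 \<subseteq> (\<Pi>\<^sub>E k\<in>K. Arr (fst (fst k)))"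
    unfolding M0_def by (intro UN_least image_subsetI restrict_PiE_iff[THEN iffD2] ballI functor_AMap[OF lF])
  have M0_small: "esmall TYPE('v) M0" unfolding M0_def by (intro esmall_UN esmall_image smX I)
  have M_small: "esmall TYPE('v) M" unfolding M_def by (rule esmall_closure_under[OF M0_small])
  have M_sub: "M \<subseteq> (\<Pi>\<^sub>E k\<in>K. Arr (fst (fst k)))"
  proof
    fix m assume "m \<in> M"
    then show "m \<in> (\<Pi>\<^sub>E k\<in>K. Arr (fst (fst k)))" unfolding M_def
    proof induction
      case (gen x) then show ?case using M0_sub by blast
    next
      case (op x y)
      show ?case
      proof (intro restrict_PiE_iff[THEN iffD2] ballI)
        fix k assume k: "k \<in> K"
        show "Comp (fst (fst k)) (x k) (y k) \<in> Arr (fst (fst k))"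
          using category_Comp[OF cK[OF k] PiE_mem[OF op.IH(2) k] PiE_mem[OF op.IH(1) k]] op.hyps(3) k by blast
      qed
    qed
  qed
  have Mk: "m k \<in> Arr (fst (fst k))" if "m \<in> M" "k \<in> K" for m k using M_sub that by auto
  \<comment> \<open>The ends of a composite are ends of its factors, so closing the arrows under
    composition adds no objects.\<close>
  have M_Dom_Cod: "(\<lambda>k\<in>K. Dom (fst (fst k)) (m k)) \<in> N \<and> (\<lambda>k\<in>K. Cod (fst (fst k)) (m k)) \<in> N" if "m \<in> M" for m
    using that unfolding M_def
  proof induction
    case (gen x)
    then obtain j a where ja: "j \<in> I" "a \<in> Arr (fst (X j))" "x = (\<lambda>k\<in>K. AMap (arr_functor (snd k j)) a)"
      by (auto simp: M0_def)
    have e: "(\<lambda>k\<in>K. Dom (fst (fst k)) (x k)) = (\<lambda>k\<in>K. OMap (arr_functor (snd k j)) (Dom (fst (X j)) a))"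
      "(\<lambda>k\<in>K. Cod (fst (fst k)) (x k)) = (\<lambda>k\<in>K. OMap (arr_functor (snd k j)) (Cod (fst (X j)) a))"
      using ja by (simp_all add: functor_Dom[OF lF] functor_Cod[OF lF] cong: restrict_cong)
    show ?case unfolding e
      using N_I[OF ja(1) category_Dom[OF cX[OF ja(1)] ja(2)]] N_I[OF ja(1) category_Cod[OF cX[OF ja(1)] ja(2)]] by blast
  next
    case (op x y)
    then have "(\<lambda>k\<in>K. Dom (fst (fst k)) ((\<lambda>k\<in>K. Comp (fst (fst k)) (x k) (y k)) k)) = (\<lambda>k\<in>K. Dom (fst (fst k)) (y k))"
      "(\<lambda>k\<in>K. Cod (fst (fst k)) ((\<lambda>k\<in>K. Comp (fst (fst k)) (x k) (y k)) k)) = (\<lambda>k\<in>K. Cod (fst (fst k)) (x k))"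
      by (simp_all add: category_Dom_Comp[OF cK] category_Cod_Comp[OF cK] Mk[unfolded M_def] cong: restrict_cong)
    then show ?case using op by simp
  qed
  obtain Q :: "'v cat" and F where Q: "Q \<in> Obj Cat" and F: "\<And>k. k \<in> K \<Longrightarrow> is_functor Q (fst (fst k)) (F k)"
    and FN: "bij_betw (\<lambda>x. \<lambda>k\<in>K. OMap (F k) x) (Obj Q) N" and FM: "bij_betw (\<lambda>x. \<lambda>k\<in>K. AMap (F k) x) (Arr Q) M"
  proof (rule subproduct_category[OF cK N_sub N_small M_sub M_small])
    show "(\<lambda>k\<in>K. Dom (fst (fst k)) (m k)) \<in> N" "(\<lambda>k\<in>K. Cod (fst (fst k)) (m k)) \<in> N" if "m \<in> M" for m
      using M_Dom_Cod[OF that] by auto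
    show "(\<lambda>k\<in>K. Comp (fst (fst k)) (n k) (m k)) \<in> M"
      if "m \<in> M" "n \<in> M" "\<And>k. k \<in> K \<Longrightarrow> Dom (fst (fst k)) (n k) = Cod (fst (fst k)) (m k)" for m n
      using closure_under.op[OF that(2)[unfolded M_def] that(1)[unfolded M_def]] that(3) unfolding M_def by blast
  next
    fix x assume "x \<in> N"
    then obtain j a where ja: "j \<in> I" "a \<in> Obj (fst (X j))" "x = (\<lambda>k\<in>K. OMap (arr_functor (snd k j)) a)"
      by (auto simp: N_def)
    then have e: "(\<lambda>k\<in>K. Ident (fst (fst k)) (x k)) = (\<lambda>k\<in>K. AMap (arr_functor (snd k j)) (Ident (fst (X j)) a))"
      by (simp add: functor_Ident[OF lF] cong: restrict_cong)
    have "(\<lambda>k\<in>K. Ident (fst (fst k)) (x k)) \<in> M0"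
      unfolding e by (rule M0_I[OF ja(1) category_Ident[OF cX[OF ja(1)] ja(2)]])
    then show "(\<lambda>k\<in>K. Ident (fst (fst k)) (x k)) \<in> M" unfolding M_def by (rule closure_under.gen)
  next
    fix S :: "'v cat" and F
    assume SF: "S \<in> Obj Cat" "\<And>k. k \<in> K \<Longrightarrow> is_functor S (fst (fst k)) (F k)"
      "bij_betw (\<lambda>x. \<lambda>k\<in>K. OMap (F k) x) (Obj S) N" "bij_betw (\<lambda>x. \<lambda>k\<in>K. AMap (F k) x) (Arr S) M"
    show thesis by (rule that[of S F]) (simp_all add: SF)
  qed
  have sQ: "small_category Q" and cQ: "category Q" using Q by (auto simp: Cat_def small_category_def)
  have cbQ: "category (base Q)" by (rule category_base[OF cQ])
  note LF = is_functor_lift[OF F]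
  (* Orbits of images of table entries under single arrows: these are closed under the action
     because arrows of the base compose, so no inductive closure is needed. *)
  define gens where "gens x = {(u, j, y, z). u \<in> Arr (base Q) \<and> Cod (base Q) u = x \<and> j \<in> I \<and>
     y \<in> Obj (base (fst (X j))) \<and> z \<in> elts (OMap (snd (X j)) y) \<and>
     (\<forall>k\<in>K. OMap (lift Q (F k)) (Dom (base Q) u) = OMap (arr_lift (snd k j)) y)}" for x
  define elt where "elt = (\<lambda>(u, j, y, z). \<lambda>k\<in>K. act (snd (fst k)) (AMap (lift Q (F k)) u) (arr_map (snd k j) y z))"
  define G where "G x = elt ` gens x" for x
  have gens_arg: "AMap (lift Q (F k)) u \<in> Arr (base (fst (fst k)))"
    "Dom (base (fst (fst k))) (AMap (lift Q (F k)) u) = OMap (lift Q (F k)) (Dom (base Q) u)"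
    "Cod (base (fst (fst k))) (AMap (lift Q (F k)) u) = OMap (lift Q (F k)) x"
    "arr_map (snd k j) y z \<in> elts (OMap (snd (fst k)) (OMap (lift Q (F k)) (Dom (base Q) u)))"
    if "(u, j, y, z) \<in> gens x" "k \<in> K" for u j y z x k
    using that functor_simps[OF LF[OF that(2)]] HomT_map[OF leg[OF that(2)], of j y z] by (auto simp: gens_def)
  have elt_k: "elt (u, j, y, z) k \<in> elts (OMap (snd (fst k)) (OMap (lift Q (F k)) x))"
    if "(u, j, y, z) \<in> gens x" "k \<in> K" for u j y z x k
    using act_closed[OF tdx_objD(5)[OF KT[OF that(2)]] gens_arg(1)[OF that], unfolded gens_arg(2,3)[OF that], OF gens_arg(4)[OF that]]
    by (simp add: elt_def that)
  have G_sub: "G x \<subseteq> (\<Pi>\<^sub>E k\<in>K. elts (OMap (snd (fst k)) (OMap (lift Q (F k)) x)))" for x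
  proof
    fix w assume "w \<in> G x"
    then obtain u j y z where w: "w = elt (u, j, y, z)" "(u, j, y, z) \<in> gens x" by (auto simp: G_def)
    have "w \<in> extensional K" by (simp add: w elt_def)
    then show "w \<in> (\<Pi>\<^sub>E k\<in>K. elts (OMap (snd (fst k)) (OMap (lift Q (F k)) x)))"
      using elt_k[OF w(2)] by (auto simp: PiE_def w(1))
  qed
  have G_small: "esmall TYPE('v) (G x)" for x
  proof -
    have "esmall TYPE('v) (Arr (base Q) \<times> (SIGMA j:I. SIGMA y:Obj (base (fst (X j))). elts (OMap (snd (X j)) y)))"
      using tdx_objD(2)[OF X] by (intro esmall_Times esmall_Sigma esmall_base sQ I esmall_elts) auto
    then have "esmall TYPE('v) (gens x)" by (rule esmall_subset) (auto simp: gens_def)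
    then show ?thesis unfolding G_def by (rule esmall_image)
  qed
  have gens_Comp: "(Comp (base Q) w u, j, y, z) \<in> gens (Cod (base Q) w)"
    "k \<in> K \<Longrightarrow> elt (Comp (base Q) w u, j, y, z) k = act (snd (fst k)) (AMap (lift Q (F k)) w) (elt (u, j, y, z) k)"
    if w: "w \<in> Arr (base Q)" and g: "(u, j, y, z) \<in> gens (Dom (base Q) w)" for w u j y z k
  proof -
    have u: "u \<in> Arr (base Q)" "Dom (base Q) w = Cod (base Q) u" using g by (auto simp: gens_def)
    show "(Comp (base Q) w u, j, y, z) \<in> gens (Cod (base Q) w)"
      using g category_Comp[OF cbQ u(1) w u(2)] category_Dom_Comp[OF cbQ u(1) w u(2)]
        category_Cod_Comp[OF cbQ u(1) w u(2)] by (auto simp: gens_def)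
    assume k: "k \<in> K"
    note gk = gens_arg[OF g k]
    have "act (snd (fst k)) (Comp (base (fst (fst k))) (AMap (lift Q (F k)) w) (AMap (lift Q (F k)) u)) (arr_map (snd k j) y z)
      = act (snd (fst k)) (AMap (lift Q (F k)) w) (act (snd (fst k)) (AMap (lift Q (F k)) u) (arr_map (snd k j) y z))"
      by (rule act_Comp[OF tdx_objD(5)[OF KT[OF k]] gk(1)])
        (use gk w functor_simps[OF LF[OF k]] in auto)
    then show "elt (Comp (base Q) w u, j, y, z) k = act (snd (fst k)) (AMap (lift Q (F k)) w) (elt (u, j, y, z) k)"
      by (simp add: elt_def k functor_Comp[OF LF[OF k] u(1) w u(2)])
  qed
  have G_act: "(\<lambda>k\<in>K. act (snd (fst k)) (AMap (lift Q (F k)) w) (v k)) \<in> G (Cod (base Q) w)"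
    if w: "w \<in> Arr (base Q)" and v: "v \<in> G (Dom (base Q) w)" for w v
  proof -
    obtain u j y z where g: "v = elt (u, j, y, z)" "(u, j, y, z) \<in> gens (Dom (base Q) w)" using v by (auto simp: G_def)
    have "(\<lambda>k\<in>K. act (snd (fst k)) (AMap (lift Q (F k)) w) (v k)) = elt (Comp (base Q) w u, j, y, z)"
    proof
      fix k show "(\<lambda>k\<in>K. act (snd (fst k)) (AMap (lift Q (F k)) w) (v k)) k = elt (Comp (base Q) w u, j, y, z) k"
        using gens_Comp(2)[OF w g(2)] g(1) by (cases "k \<in> K") (auto simp: elt_def)
    qed
    then show ?thesis using gens_Comp(1)[OF w g(2)] by (auto simp: G_def)
  qed
  obtain S p where S: "S \<in> Obj T" "fst S = Q" and p: "\<And>k. k \<in> K \<Longrightarrow> p k \<in> Hom T S (fst k)"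
    and pF: "\<And>k. k \<in> K \<Longrightarrow> arr_functor (p k) = F k"
    and pG: "\<And>x. x \<in> Obj (base Q) \<Longrightarrow> bij_betw (\<lambda>z. \<lambda>k\<in>K. arr_map (p k) x z) (elts (OMap (snd S) x)) (G x)"
    by (rule subproduct_transducer[OF KT Q F G_sub G_small G_act]) blast+
  have pL: "arr_lift (p k) = lift Q (F k)" if "k \<in> K" for k
    using HomT_lift_eq[OF p[OF that]] by (simp add: S pF that)
  have pN: "bij_betw (\<lambda>x. \<lambda>k\<in>K. OMap (arr_functor (p k)) x) (Obj Q) N"
    and pM: "bij_betw (\<lambda>x. \<lambda>k\<in>K. AMap (arr_functor (p k)) x) (Arr Q) M"
    using FN FM by (simp_all add: pF cong: restrict_cong)
  have ji: "jointly_injective K fst S p"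
    by (rule jointly_injectiveI[OF S(1) p]) (use pN pM pG in \<open>simp_all add: S\<close>)
  \<comment> \<open>The legs into \<open>S\<close> come without a formula: at a fixed
    \<open>j\<close>, the legs of all cocones factor jointly through \<open>S\<close>.\<close>
  have "\<exists>i. i \<in> Hom T (X j) S \<and> (\<forall>k\<in>K. Comp T (p k) i = snd k j)" if j: "j \<in> I" for j
  proof (rule jointly_injective_factor[OF ji S(1) X[OF j] leg[OF _ j]])
    show "(\<lambda>k\<in>K. OMap (arr_functor (snd k j)) y) \<in> (\<lambda>x. \<lambda>k\<in>K. OMap (arr_functor (p k)) x) ` Obj (fst S)"
      if "y \<in> Obj (fst (X j))" for y
      using N_I[OF j that] bij_betw_imp_surj_on[OF pN] by (simp add: S)
    show "(\<lambda>k\<in>K. AMap (arr_functor (snd k j)) y) \<in> (\<lambda>x. \<lambda>k\<in>K. AMap (arr_functor (p k)) x) ` Arr (fst S)"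
      if y: "y \<in> Arr (fst (X j))" for y
    proof -
      have "(\<lambda>k\<in>K. AMap (arr_functor (snd k j)) y) \<in> M"
        unfolding M_def by (rule closure_under.gen[OF M0_I[OF j y]])
      then show ?thesis using bij_betw_imp_surj_on[OF pM] by (simp add: S)
    qed
  next
    fix y x z assume y: "y \<in> Obj (base (fst (X j)))" and x: "x \<in> Obj (base (fst S))"
      and e: "\<And>k. k \<in> K \<Longrightarrow> OMap (arr_lift (p k)) x = OMap (arr_lift (snd k j)) y" and z: "z \<in> elts (OMap (snd (X j)) y)"
    have xQ: "x \<in> Obj (base Q)" using x by (simp add: S)
    note i = category_Ident[OF cbQ xQ] category_Dom_Ident[OF cbQ xQ] category_Cod_Ident[OF cbQ xQ]
    \<comment> \<open>The image of the entry \<open>z\<close> belongs to the generated part through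
      the identity arrow of \<open>x\<close>.\<close>
    have g: "(Ident (base Q) x, j, y, z) \<in> gens x"
      using i j y z e by (auto simp: gens_def pL)
    have "(\<lambda>k\<in>K. arr_map (snd k j) y z) = elt (Ident (base Q) x, j, y, z)"
    proof
      fix k
      have "elt (Ident (base Q) x, j, y, z) k = arr_map (snd k j) y z" if k: "k \<in> K"
        using act_Ident[OF tdx_objD(5)[OF KT[OF k]] functor_OMap[OF LF[OF k] xQ], of "arr_map (snd k j) y z"]
          gens_arg(4)[OF g k] by (simp add: elt_def k functor_Ident[OF LF[OF k] xQ] i)
      then show "(\<lambda>k\<in>K. arr_map (snd k j) y z) k = elt (Ident (base Q) x, j, y, z) k"
        by (cases "k \<in> K") (auto simp: elt_def)
    qed
    then have "(\<lambda>k\<in>K. arr_map (snd k j) y z) \<in> G x" using g by (auto simp: G_def)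
    then show "(\<lambda>k\<in>K. arr_map (snd k j) y z) \<in> (\<lambda>z. \<lambda>k\<in>K. arr_map (p k) x z) ` elts (OMap (snd S) x)"
      using bij_betw_imp_surj_on[OF pG[OF xQ]] by simp
  next
    fix g assume "g \<in> Hom T (X j) S" "\<And>k. k \<in> K \<Longrightarrow> Comp T (p k) g = snd k j"
    then show "\<exists>i. i \<in> Hom T (X j) S \<and> (\<forall>k\<in>K. Comp T (p k) i = snd k j)" by blast
  qed
  then obtain i where i: "\<And>j. j \<in> I \<Longrightarrow> i j \<in> Hom T (X j) S"
    and pi: "\<And>j k. j \<in> I \<Longrightarrow> k \<in> K \<Longrightarrow> Comp T (p k) (i j) = snd k j" by metis
  note iF = HomT_functor[OF i]
  have cocone: "is_cocone J T D S i"
    unfolding is_cocone_def X_def[symmetric] d_def[symmetric] I_def[symmetric]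
  proof (intro conjI ballI S(1) i)
    fix u assume u: "u \<in> Arr J"
    note iu = i[OF dI(1)[OF u]] i[OF dI(2)[OF u]]
    show "Comp T (i (Cod J u)) (d u) = i (Dom J u)"
    \<comment> \<open>After projection to \<open>k\<close>, the cocone equation for \<open>i\<close>
      becomes the one for the cocone \<open>k\<close>.\<close>
    proof (rule jointly_injective_imp_monic[OF ji Comp_TDX[OF d[OF u] iu(2)] iu(1)])
      show "Comp T (p k) (Comp T (i (Cod J u)) (d u)) = Comp T (p k) (i (Dom J u))" if k: "k \<in> K" for k
        using TDX_assoc[OF d[OF u] iu(2) p[OF k]] by (simp add: pi dI[OF u] k legd[OF k u])
    qed
  qed
  have piF: "comp_functor (fst (X j)) (F k) (arr_functor (i j)) = arr_functor (snd k j)" if "j \<in> I" "k \<in> K" for j k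
    using arr_functor_Comp[OF i[OF that(1)] p[OF that(2)]] pi[OF that] by (simp add: pF that)
  have pii: "OMap (F k) (OMap (arr_functor (i j)) x) = OMap (arr_functor (snd k j)) x"
    if "j \<in> I" "k \<in> K" "x \<in> Obj (fst (X j))" for j k x
    using piF[OF that(1,2)] OMap_comp_functor[OF that(3)] by metis
  have pia: "AMap (F k) (AMap (arr_functor (i j)) x) = AMap (arr_functor (snd k j)) x"
    if "j \<in> I" "k \<in> K" "x \<in> Arr (fst (X j))" for j k x
    using piF[OF that(1,2)] AMap_comp_functor[OF that(3)] by metis
  have piL: "OMap (lift Q (F k)) (OMap (arr_lift (i j)) x) = OMap (arr_lift (snd k j)) x"
    if "j \<in> I" "k \<in> K" "x \<in> Obj (base (fst (X j)))" for j k x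
    using arr_lift_Comp[OF i[OF that(1)] p[OF that(2)]] pi[OF that(1,2)] OMap_comp_functor[OF that(3)] pL[OF that(2)] by metis
  have iO: "OMap (arr_functor (i j)) x \<in> Obj Q" if "j \<in> I" "x \<in> Obj (fst (X j))" for j x
    using functor_OMap[OF iF[OF that(1)] that(2)] by (simp add: S)
  have iA: "AMap (arr_functor (i j)) x \<in> Arr Q" if "j \<in> I" "x \<in> Arr (fst (X j))" for j x
    using functor_AMap[OF iF[OF that(1)] that(2)] by (simp add: S)
  have FO_inj: "x = y" if "x \<in> Obj Q" "y \<in> Obj Q" "\<And>k. k \<in> K \<Longrightarrow> OMap (F k) x = OMap (F k) y" for x y
    by (rule ji_Obj[OF ji]) (use that in \<open>simp_all add: S pF\<close>)
  have FA_inj: "x = y" if "x \<in> Arr Q" "y \<in> Arr Q" "\<And>k. k \<in> K \<Longrightarrow> AMap (F k) x = AMap (F k) y" for x y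
    by (rule ji_Arr[OF ji]) (use that in \<open>simp_all add: S pF\<close>)
  have unique: "h = h'" if h: "h \<in> Hom T S Y" and h': "h' \<in> Hom T S Y" and ne: "K \<noteq> {}"
    and eq: "\<And>j. j \<in> I \<Longrightarrow> Comp T h (i j) = Comp T h' (i j)" for h h' Y
  proof -
    note hF = HomT_functor[OF h, unfolded S] and hF' = HomT_functor[OF h', unfolded S]
    have eqF: "comp_functor (fst (X j)) (arr_functor h) (arr_functor (i j)) =
        comp_functor (fst (X j)) (arr_functor h') (arr_functor (i j))" if j: "j \<in> I" for j
      using arr_functor_Comp[OF i[OF j] h] arr_functor_Comp[OF i[OF j] h'] eq[OF j] by simp
    have "OMap (arr_functor h) x = OMap (arr_functor h') x" if x: "x \<in> Obj Q" for x
    proof -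
      have "(\<lambda>k\<in>K. OMap (F k) x) \<in> N" using x FN by (auto simp: bij_betw_def)
      then obtain j a where ja: "j \<in> I" "a \<in> Obj (fst (X j))"
        "(\<lambda>k\<in>K. OMap (F k) x) = (\<lambda>k\<in>K. OMap (arr_functor (snd k j)) a)" by (auto simp: N_def)
      have "OMap (F k) x = OMap (F k) (OMap (arr_functor (i j)) a)" if "k \<in> K" for k
        using fun_cong[OF ja(3), of k] that by (simp add: pii[OF ja(1) that ja(2)])
      then have "x = OMap (arr_functor (i j)) a" by (rule FO_inj[OF x iO[OF ja(1,2)]])
      then show ?thesis using eqF[OF ja(1)] OMap_comp_functor[OF ja(2)] by metis
    qed
    \<comment> \<open>Induction over the closure, with the arrow of \<open>Q\<close> quantified
      inside the claim: the factors of a composite family are represented by arrows \<open>a\<close>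
      and \<open>b\<close> of \<open>Q\<close>, to which the induction hypotheses then
      apply.\<close>
    moreover have "\<forall>x\<in>Arr Q. (\<lambda>k\<in>K. AMap (F k) x) = m \<longrightarrow> AMap (arr_functor h) x = AMap (arr_functor h') x"
      if "m \<in> M" for m
      using that unfolding M_def
    proof induction
      case (gen m)
      show ?case
      proof (intro ballI impI)
        fix x assume x: "x \<in> Arr Q" "(\<lambda>k\<in>K. AMap (F k) x) = m"
        obtain j a where ja: "j \<in> I" "a \<in> Arr (fst (X j))" "m = (\<lambda>k\<in>K. AMap (arr_functor (snd k j)) a)"
          using gen by (auto simp: M0_def)
        have "AMap (F k) x = AMap (F k) (AMap (arr_functor (i j)) a)" if "k \<in> K" for k
          using fun_cong[OF x(2), of k] that by (simp add: ja(3) pia[OF ja(1) that ja(2)])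
        then have "x = AMap (arr_functor (i j)) a" by (rule FA_inj[OF x(1) iA[OF ja(1,2)]])
        then show "AMap (arr_functor h) x = AMap (arr_functor h') x"
          using eqF[OF ja(1)] AMap_comp_functor[OF ja(2)] by metis
      qed
    next
      case (op n m)
      show ?case
      proof (intro ballI impI)
        fix x assume x: "x \<in> Arr Q" "(\<lambda>k\<in>K. AMap (F k) x) = (\<lambda>k\<in>K. Comp (fst (fst k)) (n k) (m k))"
        obtain a where a: "a \<in> Arr Q" "(\<lambda>k\<in>K. AMap (F k) a) = n"
          using op.hyps(1) FM unfolding M_def[symmetric] bij_betw_def by blast
        obtain b where b: "b \<in> Arr Q" "(\<lambda>k\<in>K. AMap (F k) b) = m"
          using op.hyps(2) FM unfolding M_def[symmetric] bij_betw_def by blast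
        have ab: "n k = AMap (F k) a" "m k = AMap (F k) b" if "k \<in> K" for k
          using that by (simp_all flip: a(2) b(2))
        \<comment> \<open>The closure condition gives composability in every component; joint
          injectivity on objects turns it into composability in \<open>Q\<close>.\<close>
        have c: "Dom Q a = Cod Q b"
        proof (rule FO_inj[OF category_Dom[OF cQ a(1)] category_Cod[OF cQ b(1)]])
          show "OMap (F k) (Dom Q a) = OMap (F k) (Cod Q b)" if k: "k \<in> K" for k
            using bspec[OF op.hyps(3) k] by (simp add: k ab functor_Dom[OF F[OF k] a(1)] functor_Cod[OF F[OF k] b(1)])
        qed
        have "x = Comp Q a b"
        proof (rule FA_inj[OF x(1) category_Comp[OF cQ b(1) a(1) c]])
          show "AMap (F k) x = AMap (F k) (Comp Q a b)" if k: "k \<in> K" for k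
            using fun_cong[OF x(2), of k] k by (simp add: ab functor_Comp[OF F[OF k] b(1) a(1) c])
        qed
        then show "AMap (arr_functor h) x = AMap (arr_functor h') x"
          using bspec[OF op.IH(1) a(1), THEN mp, OF a(2)] bspec[OF op.IH(2) b(1), THEN mp, OF b(2)]
          by (simp add: functor_Comp[OF hF b(1) a(1) c] functor_Comp[OF hF' b(1) a(1) c])
      qed
    qed
    then have "AMap (arr_functor h) x = AMap (arr_functor h') x" if "x \<in> Arr Q" for x
      using that FM unfolding bij_betw_def by blast
    ultimately have hh: "arr_functor h = arr_functor h'" by (rule functor_eqI[OF hF hF'])
    then have Lhh: "arr_lift h = arr_lift h'" by (simp add: HomT_lift_eq[OF h] HomT_lift_eq[OF h'])
    show ?thesis
    proof (rule HomT_eqI[OF h h' hh])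
      fix x z assume "x \<in> Obj (base (fst S))" and z: "z \<in> elts (OMap (snd S) x)"
      then have x: "x \<in> Obj (base Q)" by (simp add: S)
      have "(\<lambda>k\<in>K. arr_map (p k) x z) \<in> G x" using bij_betw_imp_surj_on[OF pG[OF x]] z by blast
      then obtain u j y w where g: "(u, j, y, w) \<in> gens x" "(\<lambda>k\<in>K. arr_map (p k) x z) = elt (u, j, y, w)"
        by (auto simp: G_def)
      have u: "u \<in> Arr (base Q)" "Cod (base Q) u = x" and j: "j \<in> I" and y: "y \<in> Obj (base (fst (X j)))"
        and w: "w \<in> elts (OMap (snd (X j)) y)" using g(1) by (auto simp: gens_def)
      note Dy = functor_OMap[OF HomT_lift[OF i[OF j]] y, unfolded S]
      \<comment> \<open>\<open>gens\<close> records only that the two indices agree under every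
        projection, since it was defined before the legs \<open>i\<close> were available. With
        \<open>K\<close> nonempty this agreement becomes an equality of indices in
        \<open>base Q\<close>.\<close>
      have Du: "Dom (base Q) u = OMap (arr_lift (i j)) y"
      proof (rule lift_jointly_injective[OF category_Dom[OF cbQ u(1)] Dy ne FO_inj])
        show "OMap (lift Q (F k)) (Dom (base Q) u) = OMap (lift Q (F k)) (OMap (arr_lift (i j)) y)"
          if k: "k \<in> K" for k
          using g(1) k unfolding piL[OF j k y] gens_def by blast
      qed
      define v where "v = arr_map (i j) y w"
      have v: "v \<in> elts (OMap (snd S) (Dom (base Q) u))" using HomT_map[OF i[OF j] y w] by (simp add: v_def Du)
      note uS = u(1)[folded S(2)] and vS = v[folded S(2)]
      \<comment> \<open>Every entry of \<open>S\<close> arises by acting on the image of a diagram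
        entry, so naturality reduces \<open>h\<close> and \<open>h'\<close> to their values on that
        image.\<close>
      have "z = act (snd S) u v"
      proof (rule ji_elts[OF ji x[folded S(2)] z])
        show "act (snd S) u v \<in> elts (OMap (snd S) x)"
          using act_closed[OF tdx_objD(5)[OF S(1)] uS vS] by (simp add: S u)
        show "arr_map (p k) x z = arr_map (p k) x (act (snd S) u v)" if k: "k \<in> K" for k
        proof -
          have "arr_map (p k) (Dom (base Q) u) v = arr_map (snd k j) y w"
            using arr_map_Comp[OF i[OF j] p[OF k] y w] by (simp add: pi j k v_def Du)
          then have "arr_map (p k) x (act (snd S) u v) = act (snd (fst k)) (AMap (lift Q (F k)) u) (arr_map (snd k j) y w)"
            using HomT_natural[OF p[OF k] uS vS] by (simp add: S u pL k)
          also have "\<dots> = arr_map (p k) x z" using fun_cong[OF g(2), of k] k by (simp add: elt_def)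
          finally show ?thesis by simp
        qed
      qed
      moreover have "arr_map h (Dom (base Q) u) v = arr_map h' (Dom (base Q) u) v"
        using arr_map_Comp[OF i[OF j] h y w] arr_map_Comp[OF i[OF j] h' y w] eq[OF j] by (simp add: v_def Du)
      ultimately show "arr_map h x z = arr_map h' x z"
        using HomT_natural[OF h uS vS] HomT_natural[OF h' uS vS] by (simp add: S u Lhh)
    qed
  qed
  have "\<exists>!h. h \<in> Hom T S Y \<and> (\<forall>j\<in>Obj J. Comp T h (i j) = q j)" if c: "is_cocone J T D Y q" for Y q
  proof (rule ex1I[of _ "p (Y, q)"])
    \<comment> \<open>The given cocone is itself an index: its projection mediates, and its presence
      makes \<open>K\<close> nonempty, as \<open>unique\<close> requires.\<close>
    have k: "(Y, q) \<in> K" using c by (simp add: K_def)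
    show *: "p (Y, q) \<in> Hom T S Y \<and> (\<forall>j\<in>Obj J. Comp T (p (Y, q)) (i j) = q j)"
      using p[OF k] pi[OF _ k] by (simp add: I_def)
    show "h = p (Y, q)" if "h \<in> Hom T S Y \<and> (\<forall>j\<in>Obj J. Comp T h (i j) = q j)" for h
      by (rule unique[of _ Y]) (use that * k in \<open>auto simp: I_def\<close>)
  qed
  then show ?thesis using cocone unfolding is_colimit_def by blast
qed

end

theorem mainTheorem6:
  fixes A B :: "('v::zfc_universe, 'v) category"
  assumes "small_category A" and "small_category B"
  shows "fibration (TDX A B) Cat (tdx_forget A B) \<and>
    small_complete TYPE('v) (TDX A B) \<and> small_cocomplete TYPE('v) (TDX A B)"
proof -
  interpret transducers A B using assms by unfold_locales
  show ?thesis
    unfolding small_complete_def small_cocomplete_def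
    using fibration_forget category_TDX TDX_has_limit TDX_has_colimit by blast
qed

end
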